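(* Let $d\ge 1$, let $\Lambda\subset\mathbb{R}^d$ be a $d$-dimensional lattice and let $C\subset\mathbb{R}^d$ be a convex body. (1) If $C$ is lattice reduced with respect to $\Lambda$, then $C$ is a polytope with at most $2^{d+1}-2$ vertices. (2) If $C$ is lattice complete with respect to $\Lambda$, then $C$ is a polytope with at most $2^{d+1}-2$ facets. In both statements the bound $2^{d+1}-2$ cannot be improved: for every $d$ there exist a $d$-dimensional lattice and a lattice reduced polytope with exactly $2^{d+1}-2$ vertices, and a $d$-dimensional lattice and a lattice complete polytope with exactly $2^{d+1}-2$ facets.
   Context: A convex body is a compact convex set in $\mathbb{R}^d$ with non-empty interior. A lattice $\Lambda\subset\mathbb{R}^d$ is a discrete subgroup of $\mathbb{R}^d$; it is $d$-dimensional if it spans $\mathbb{R}^d$. The dual lattice is $\Lambda^\star=\{y\in\mathbb{R}^d: x\cdot y\in\mathbb{Z}\ \forall x\in\Lambda\}$. The lattice width of a convex body $C$ is $\mathrm{wdt}_\Lambda(C)=\min_{y\in\Lambda^\star\setminus\{0\}}\max_{a,b\in C} y\cdot(a-b)$. A segment $I=[a,b]$ is a lattice segment if $b-a$ is parallel to some nonzero vector of $\Lambda$; then $v_I$ denotes the unique generator of $\Lambda\cap\mathrm{span}\{b-a\}$ that is a positive multiple of $b-a$, and the lattice length of $I$ is $|b-a|/|v_I|$ (Euclidean norms). The lattice diameter $\mathrm{diam}_\Lambda(C)$ is the maximum lattice length of a lattice segment contained in $C$. $C$ is lattice reduced w.r.t. $\Lambda$ if no convex body $C'\subsetneq C$ has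 $\mathrm{wdt}_\Lambda(C')=\mathrm{wdt}_\Lambda(C)$; $C$ is lattice complete w.r.t. $\Lambda$ if no convex body $C'\supsetneq C$ has $\mathrm{diam}_\Lambda(C')=\mathrm{diam}_\Lambda(C)$. *)

theory Defs
  imports "HOL-Analysis.Analysis"
begin

definition convex_body :: "'a::euclidean_space set \<Rightarrow> bool" where
  "convex_body C \<longleftrightarrow> compact C \<and> convex C \<and> interior C \<noteq> {}"

definition full_lattice :: "'a::euclidean_space set \<Rightarrow> bool" where
  "full_lattice L \<longleftrightarrow> 0 \<in> L \<and> (\<forall>x\<in>L. \<forall>y\<in>L. x - y \<in> L)
     \<and> (\<exists>e>0. \<forall>x\<in>L. x \<noteq> 0 \<longrightarrow> e \<le> norm x) \<and> span L = UNIV"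

definition dual_lattice :: "'a::euclidean_space set \<Rightarrow> 'a set" where
  "dual_lattice L = {y. \<forall>x\<in>L. x \<bullet> y \<in> \<int>}"

definition lattice_width :: "'a::euclidean_space set \<Rightarrow> 'a set \<Rightarrow> real" where
  "lattice_width L C =
     (INF y \<in> dual_lattice L - {0}. (SUP p \<in> C \<times> C. y \<bullet> (fst p - snd p)))"

definition lattice_gen :: "'a::euclidean_space set \<Rightarrow> 'a \<Rightarrow> 'a" where
  "lattice_gen L u = (THE v. v \<in> L \<and> (\<exists>t>0. v = t *\<^sub>R u) \<and>
      (\<forall>w\<in>L. (\<exists>s. w = s *\<^sub>R u) \<longrightarrow> (\<exists>k::int. w = of_int k *\<^sub>R v)))"

definition lattice_segment :: "'a::euclidean_space set \<Rightarrow> 'a \<Rightarrow> 'a \<Rightarrow> bool" where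
  "lattice_segment L a b \<longleftrightarrow> (\<exists>w\<in>L. w \<noteq> 0 \<and> (\<exists>t. b - a = t *\<^sub>R w))"

definition lattice_length :: "'a::euclidean_space set \<Rightarrow> 'a \<Rightarrow> 'a \<Rightarrow> real" where
  "lattice_length L a b = norm (b - a) / norm (lattice_gen L (b - a))"

text \<open>Lattice diameter: maximal lattice length of a lattice segment [a,b] in C
  (degenerate segments have length 0).\<close>
definition lattice_diam :: "'a::euclidean_space set \<Rightarrow> 'a set \<Rightarrow> real" where
  "lattice_diam L C = Sup ({0} \<union> {lattice_length L a b | a b.
      a \<in> C \<and> b \<in> C \<and> a \<noteq> b \<and> closed_segment a b \<subseteq> C \<and> lattice_segment L a b})"

definition lattice_reduced :: "'a::euclidean_space set \<Rightarrow> 'a set \<Rightarrow> bool" where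
  "lattice_reduced L C \<longleftrightarrow> convex_body C \<and>
     (\<forall>C'. convex_body C' \<and> C' \<subset> C \<longrightarrow> lattice_width L C' \<noteq> lattice_width L C)"

definition lattice_complete :: "'a::euclidean_space set \<Rightarrow> 'a set \<Rightarrow> bool" where
  "lattice_complete L C \<longleftrightarrow> convex_body C \<and>
     (\<forall>C'. convex_body C' \<and> C \<subset> C' \<longrightarrow> lattice_diam L C' \<noteq> lattice_diam L C)"

end

theory Submission
  imports Defs
begin

text \<open>Let \<open>M\<close> be the dual lattice in part (1) and \<open>L\<close> itself in part (2). If \<open>C\<close> is reduced, cutting off
  a small cap at an extreme point \<open>v\<close> lowers the width, so some \<open>y \<in> M\<close> attaining the width has
  \<open>v\<close> as its only maximiser on \<open>C\<close>. If \<open>C\<close> is complete, adding a point near a smooth boundary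
  point raises the diameter, so \<open>C\<close> is the intersection of the halfspaces given by those diametral
  vectors \<open>v \<in> M\<close> for which the body \<open>C - C\<close> has a unique normal at \<open>diam v\<close>. In both cases, if two such
  vectors \<open>v \<noteq> \<plusminus>v'\<close> are congruent modulo \<open>2M\<close>, then \<open>(v + v') / 2 \<in> M\<close> is again extremal, which forces
  the same vertex, respectively the same normal. So every class modulo \<open>2M\<close> contributes at most two
  vertices or facets, the zero class contributes none, and there are at most \<open>2^d\<close> classes.

  For sharpness, finitely many vectors \<open>\<plusminus>weight_vector S\<close> are paired with the integer vectors \<open>\<plusminus>\<Sum>S\<close>
  so that their convex hull is reduced and its polar is complete with respect to the integer
  lattice.\<close>

section \<open>Classes of a discrete subgroup modulo its double\<close>

text \<open>Width is a minimum over functionals in the dual lattice and diameter a maximum over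
  vectors of the lattice, so the two parts are mirror images: minimality, respectively maximality,
  applied to the average of two congruent vectors forces equality in every estimate. The exception
  v' = -v is unavoidable, since v - (-v) = 2v; hence 2 * (2^d - 1). The obstacle is that neither
  hypothesis supplies unique maximisers or normals. For a reduced body the direction found depends
  on the cap, and only discreteness lets one direction serve arbitrarily small caps. For a complete
  body a diametral vector may have many normals; such a vector cannot stop the body from growing at
  a smooth boundary point, because one of its normals is neither the normal there nor its opposite.
  In the examples the weight vector of S and the indicator vector of T pair to absolute value at
  most 1, with equality only for S = T. This one table of pairings yields both the vertices of the
  hull and the facets of its polar.\<close>

definition discrete_subgroup :: "'a::euclidean_space set \<Rightarrow> bool" where
  "discrete_subgroup M \<longleftrightarrow> 0 \<in> M \<and> (\<forall>x\<in>M. \<forall>y\<in>M. x - y \<in> M)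
     \<and> (\<exists>e>0. \<forall>x\<in>M. x \<noteq> 0 \<longrightarrow> e \<le> norm x)"

definition cong_double :: "'a::euclidean_space set \<Rightarrow> 'a \<Rightarrow> 'a \<Rightarrow> bool" where
  "cong_double M x y \<longleftrightarrow> (\<exists>z\<in>M. x - y = z + z)"

lemma discrete_subgroup_diff: "discrete_subgroup M \<Longrightarrow> x \<in> M \<Longrightarrow> y \<in> M \<Longrightarrow> x - y \<in> M"
  by (simp add: discrete_subgroup_def)

lemma discrete_subgroup_zero: "discrete_subgroup M \<Longrightarrow> 0 \<in> M"
  by (simp add: discrete_subgroup_def)

lemma discrete_subgroup_uminus: "discrete_subgroup M \<Longrightarrow> x \<in> M \<Longrightarrow> - x \<in> M"
  using discrete_subgroup_diff[of M 0 x] discrete_subgroup_zero[of M] by simp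

lemma discrete_subgroup_add: "discrete_subgroup M \<Longrightarrow> x \<in> M \<Longrightarrow> y \<in> M \<Longrightarrow> x + y \<in> M"
  using discrete_subgroup_diff[of M x "-y"] discrete_subgroup_uminus[of M y] by simp

lemma discrete_subgroup_of_int_scaleR:
  assumes "discrete_subgroup M" "x \<in> M"
  shows "of_int k *\<^sub>R x \<in> M"
proof -
  have nat: "of_nat n *\<^sub>R x \<in> M" for n
    by (induction n)
       (auto simp: algebra_simps discrete_subgroup_zero[OF assms(1)]
         discrete_subgroup_add[OF assms(1) assms(2)])
  show ?thesis
  proof (cases "k \<ge> 0")
    case True
    then show ?thesis using nat[of "nat k"] by simp
  next
    case False
    then have "of_int k *\<^sub>R x = - (of_nat (nat (-k)) *\<^sub>R x)" by simp
    then show ?thesis using discrete_subgroup_uminus[OF assms(1) nat[of "nat (-k)"]] by simp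
  qed
qed

text \<open>Scale coordinates by s = d/e and round down: points in the same cell differ by less than
  e/d in each coordinate, hence by less than e in the l1 norm, and so coincide. It remains to count
  cells. Only the growth exponent d matters later, so the constants are generous.\<close>

lemma discrete_subgroup_card_cball:
  fixes M :: "'a::euclidean_space set"
  assumes "discrete_subgroup M"
  obtains c where "c > 0"
    "\<And>r. 0 \<le> r \<Longrightarrow> finite (M \<inter> cball 0 r) \<and> real (card (M \<inter> cball 0 r)) \<le> (c * r + 3) ^ DIM('a)"
proof -
  obtain e where e: "e > 0" "\<And>x. x \<in> M \<Longrightarrow> x \<noteq> 0 \<Longrightarrow> e \<le> norm x"
    using assms unfolding discrete_subgroup_def by blast
  define s where "s = real DIM('a) / e"
  have s: "s > 0" using e by (simp add: s_def)
  \<comment> \<open>Restricting to \<open>Basis\<close> makes the cell index an extensional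
    function, so that the possible indices form a \<open>PiE\<close> set of known
    cardinality.\<close>
  define fl :: "'a \<Rightarrow> 'a \<Rightarrow> int" where "fl x = restrict (\<lambda>i. \<lfloor>s * (x \<bullet> i)\<rfloor>) Basis" for x
  have inj: "inj_on fl M"
  proof (rule inj_onI)
    fix x y assume x: "x \<in> M" and y: "y \<in> M" and eq: "fl x = fl y"
    have "\<bar>(x - y) \<bullet> i\<bar> < e / real DIM('a)" if "i \<in> Basis" for i
    proof -
      have "\<lfloor>s * (x \<bullet> i)\<rfloor> = \<lfloor>s * (y \<bullet> i)\<rfloor>"
        using fun_cong[OF eq, of i] that by (simp add: fl_def)
      then have "\<bar>s * (x \<bullet> i) - s * (y \<bullet> i)\<bar> < 1" by linarith
      then have "\<bar>s * ((x - y) \<bullet> i)\<bar> < 1" by (simp add: algebra_simps)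
      then have "s * \<bar>(x - y) \<bullet> i\<bar> < 1" using s by (simp add: abs_mult)
      then show ?thesis using e by (simp add: s_def field_simps)
    qed
    then have "(\<Sum>i\<in>Basis. \<bar>(x - y) \<bullet> i\<bar>) < (\<Sum>i\<in>(Basis::'a set). e / real DIM('a))"
      by (intro sum_strict_mono) auto
    then have "norm (x - y) < e"
      using norm_le_l1[of "x - y"] by simp
    then show "x = y"
      using e(2)[of "x - y"] discrete_subgroup_diff[OF assms x y] by auto
  qed
  have "finite (M \<inter> cball 0 r) \<and> real (card (M \<inter> cball 0 r)) \<le> (2 * s * r + 3) ^ DIM('a)"
    if r: "0 \<le> r" for r
  proof -
    define N where "N = \<lceil>s * r\<rceil>"
    have "0 \<le> s * r" using s r by simp
    then have N0: "N \<ge> 0" unfolding N_def by linarith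
    define T where "T = (Basis::'a set) \<rightarrow>\<^sub>E {-N..N}"
    have T: "fl ` (M \<inter> cball 0 r) \<subseteq> T"
    proof
      fix g assume "g \<in> fl ` (M \<inter> cball 0 r)"
      then obtain x where x: "norm x \<le> r" and g: "g = fl x" by auto
      show "g \<in> T"
        unfolding T_def g
      proof (rule PiE_I)
        fix i :: 'a assume i: "i \<in> Basis"
        have "\<bar>x \<bullet> i\<bar> \<le> r" using Basis_le_norm[OF i, of x] x by linarith
        then have "\<bar>s * (x \<bullet> i)\<bar> \<le> s * r" using s by (simp add: abs_mult)
        then show "fl x i \<in> {-N..N}"
          using i by (simp add: fl_def N_def) linarith
      qed (simp add: fl_def)
    qed
    have finT: "finite T" unfolding T_def by (intro finite_PiE) auto
    have fin: "finite (M \<inter> cball 0 r)"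
      using finite_subset[OF T finT] inj_on_subset[OF inj, of "M \<inter> cball 0 r"]
      by (meson finite_imageD inf_le1)
    have "card (M \<inter> cball 0 r) \<le> card T"
      by (intro card_inj_on_le[OF _ T finT] inj_on_subset[OF inj]) auto
    also have "card T = nat (2 * N + 1) ^ DIM('a)"
      unfolding T_def by (simp add: card_PiE)
    finally have "real (card (M \<inter> cball 0 r)) \<le> real (nat (2 * N + 1)) ^ DIM('a)"
      by (metis of_nat_le_iff of_nat_power)
    also have "\<dots> \<le> (2 * s * r + 3) ^ DIM('a)"
    proof (rule power_mono)
      have "of_int N \<le> s * r + 1" unfolding N_def by linarith
      then show "real (nat (2 * N + 1)) \<le> 2 * s * r + 3" using N0 by simp
    qed simp
    finally show ?thesis using fin by simp
  qed
  then show ?thesis using that[of "2 * s"] s by auto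
qed

lemma discrete_subgroup_finite_bounded:
  assumes "discrete_subgroup M"
  shows "finite {x \<in> M. norm x \<le> r}"
proof (cases "r \<ge> 0")
  case True
  obtain c where "finite (M \<inter> cball 0 r)"
    using discrete_subgroup_card_cball[OF assms] True by metis
  then show ?thesis by (rule finite_subset[rotated]) auto
next
  case False
  have "\<not> norm x \<le> r" for x :: 'a using False norm_ge_zero[of x] by linarith
  then have "{x \<in> M. norm x \<le> r} = {}" by blast
  then show ?thesis by (simp only: finite.emptyI)
qed

text \<open>This is the sum of 2^k x_k with the lowest digit at the head; the head is thus the value
  modulo twice the subgroup.\<close>

fun binary_value :: "'a::euclidean_space list \<Rightarrow> 'a" where
  "binary_value [] = 0"
| "binary_value (x # xs) = x + (binary_value xs + binary_value xs)"

text \<open>Binary expansions of length \<open>n\<close> with digits in \<open>R\<close> are distinct elements of \<open>M\<close> of norm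
  \<open>O(2^n)\<close>, and there are only \<open>O(2^(dn))\<close> such elements.\<close>
lemma card_incongruent_finite:
  fixes M :: "'a::euclidean_space set"
  assumes M: "discrete_subgroup M" and R: "finite R" "R \<subseteq> M"
    and inc: "\<And>x y. x \<in> R \<Longrightarrow> y \<in> R \<Longrightarrow> cong_double M x y \<Longrightarrow> x = y"
  shows "card R \<le> 2 ^ DIM('a)"
proof (rule ccontr)
  assume "\<not> card R \<le> 2 ^ DIM('a)"
  then have gt: "real (card R) > 2 ^ DIM('a)"
    by (metis not_le of_nat_less_iff of_nat_numeral of_nat_power)
  obtain c where c: "c > 0"
    and cb: "\<And>r. 0 \<le> r \<Longrightarrow> finite (M \<inter> cball 0 r)"
      "\<And>r. 0 \<le> r \<Longrightarrow> real (card (M \<inter> cball 0 r)) \<le> (c * r + 3) ^ DIM('a)"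
    using discrete_subgroup_card_cball[OF M] by metis
  obtain B where B: "B > 0" "\<And>x. x \<in> R \<Longrightarrow> norm x \<le> B"
    using finite_imp_bounded[OF R(1)] unfolding bounded_pos by auto
  define X where "X n = {xs. set xs \<subseteq> R \<and> length xs = n}" for n
  have inM: "binary_value xs \<in> M" if "set xs \<subseteq> R" for xs
    using that R(2) by (induction xs) (auto intro: discrete_subgroup_add[OF M] discrete_subgroup_zero[OF M])
  have nrm: "norm (binary_value xs) \<le> (2 ^ length xs - 1) * B" if "set xs \<subseteq> R" for xs
    using that
  proof (induction xs)
    case (Cons x xs)
    have "norm (binary_value (x # xs)) \<le> norm x + (norm (binary_value xs) + norm (binary_value xs))"
      using norm_triangle_ineq[of x "binary_value xs + binary_value xs"]
        norm_triangle_ineq[of "binary_value xs" "binary_value xs"] by simp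
    also have "\<dots> \<le> B + ((2 ^ length xs - 1) * B + (2 ^ length xs - 1) * B)"
      using Cons B by (intro add_mono) auto
    finally show ?case by (simp add: algebra_simps)
  qed simp
  have inj: "xs = ys" if "set xs \<subseteq> R" "set ys \<subseteq> R" "length xs = length ys"
    "binary_value xs = binary_value ys" for xs ys
    using that(3,1,2,4)
  proof (induction xs ys rule: list_induct2)
    case (Cons x xs y ys)
    \<comment> \<open>The tails enter doubled, so equal values have congruent lowest digits.
      Incongruence in \<open>R\<close> makes the digits equal; they cancel, and halving leaves equal
      values of the tails.\<close>
    have "x - y = (binary_value ys - binary_value xs) + (binary_value ys - binary_value xs)"
      using Cons.prems(3) by (simp add: algebra_simps)
    then have "x = y"
      using inc[of x y] Cons.prems(1,2) inM[of xs] inM[of ys]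
        discrete_subgroup_diff[OF M, of "binary_value ys" "binary_value xs"]
      unfolding cong_double_def by fastforce
    with Cons show ?case by (auto simp flip: scaleR_2)
  qed simp
  \<comment> \<open>Since 2^n is at least 1, the additive 3 can be absorbed into a factor 2^n, which
    leaves a constant \<open>K\<close> independent of n.\<close>
  define K where "K = c * B + 3"
  have bnd: "real (card R) ^ n \<le> (2 ^ DIM('a)) ^ n * K ^ DIM('a)" for n
  proof -
    have "card R ^ n = card (X n)" unfolding X_def by (simp add: card_lists_length_eq R)
    also have "\<dots> = card (binary_value ` X n)"
      by (rule card_image[symmetric]) (auto intro!: inj_onI inj simp: X_def)
    also have "\<dots> \<le> card (M \<inter> cball 0 (2 ^ n * B))"
    proof (rule card_mono)
      show "finite (M \<inter> cball 0 (2 ^ n * B))" using cb B by simp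
      show "binary_value ` X n \<subseteq> M \<inter> cball 0 (2 ^ n * B)"
      proof
        fix z assume "z \<in> binary_value ` X n"
        then obtain xs where xs: "set xs \<subseteq> R" "length xs = n" "z = binary_value xs" unfolding X_def by auto
        have "norm z \<le> 2 ^ n * B"
          using nrm[OF xs(1)] xs(2,3) B(1) by (simp add: algebra_simps)
        then show "z \<in> M \<inter> cball 0 (2 ^ n * B)" using inM xs by simp
      qed
    qed
    finally have "real (card R ^ n) \<le> real (card (M \<inter> cball 0 (2 ^ n * B)))" by (rule of_nat_mono)
    also have "\<dots> \<le> (c * (2 ^ n * B) + 3) ^ DIM('a)" using cb(2) B by simp
    also have "\<dots> \<le> (2 ^ n * K) ^ DIM('a)"
      using c B by (intro power_mono) (auto simp: K_def algebra_simps)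
    also have "\<dots> = (2 ^ DIM('a)) ^ n * K ^ DIM('a)"
      by (simp only: power_mult_distrib mult.commute flip: power_mult)
    finally show ?thesis by simp
  qed
  \<comment> \<open>Dividing \<open>bnd\<close> by 2^(dn) bounds q^n by a constant for every n,
    which is impossible for q > 1.\<close>
  define q where "q = real (card R) / 2 ^ DIM('a)"
  have "q > 1" using gt by (simp add: q_def)
  then obtain n where "K ^ DIM('a) < q ^ n" using real_arch_pow by blast
  moreover have "q ^ n \<le> K ^ DIM('a)"
    using bnd[of n] by (simp add: q_def power_divide field_simps)
  ultimately show False by simp
qed

lemma card_incongruent:
  fixes M :: "'a::euclidean_space set"
  assumes M: "discrete_subgroup M" and R: "R \<subseteq> M"
    and inc: "\<And>x y. x \<in> R \<Longrightarrow> y \<in> R \<Longrightarrow> cong_double M x y \<Longrightarrow> x = y"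
  shows "finite R \<and> card R \<le> 2 ^ DIM('a)"
proof -
  have fin: "finite R"
  proof (rule ccontr)
    assume "infinite R"
    then obtain S where S: "S \<subseteq> R" "finite S" "card S = Suc (2 ^ DIM('a))"
      using infinite_arbitrarily_large by blast
    have "card S \<le> 2 ^ DIM('a)"
      by (rule card_incongruent_finite[OF M S(2)]) (use S R inc in blast)+
    then show False using S by simp
  qed
  then show ?thesis using card_incongruent_finite[OF M fin R inc] by simp
qed

section \<open>From incongruent sets to values of a function on congruence classes\<close>

lemma cong_double_sym:
  assumes "discrete_subgroup M" "cong_double M x y" shows "cong_double M y x"
proof -
  obtain z where "z \<in> M" "x - y = z + z" using assms unfolding cong_double_def by auto
  then have "- z \<in> M \<and> y - x = - z + - z"
    using discrete_subgroup_uminus[OF assms(1)] by (simp add: algebra_simps)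
  then show ?thesis unfolding cong_double_def by blast
qed

lemma cong_double_trans:
  assumes "discrete_subgroup M" "cong_double M x y" "cong_double M y w" shows "cong_double M x w"
proof -
  obtain z z' where "z \<in> M" "x - y = z + z" "z' \<in> M" "y - w = z' + z'"
    using assms unfolding cong_double_def by auto
  then have "z + z' \<in> M \<and> x - w = (z + z') + (z + z')"
    using discrete_subgroup_add[OF assms(1)] by (simp add: algebra_simps)
  then show ?thesis unfolding cong_double_def by blast
qed

text \<open>Fix a representative r of each class met by \<open>V\<close>. Any other member of the
  class is either -r or has the same value of f as r, so each class accounts for at most the two
  values f r and f (- r).\<close>

lemma card_image_nonzero_classes:
  fixes M :: "'a::euclidean_space set" and f :: "'a \<Rightarrow> 'b"
  assumes M: "discrete_subgroup M" and V: "V \<subseteq> M"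
    and nz: "\<And>v. v \<in> V \<Longrightarrow> \<not> cong_double M v 0"
    and eq: "\<And>v v'. v \<in> V \<Longrightarrow> v' \<in> V \<Longrightarrow> cong_double M v v' \<Longrightarrow> v' \<noteq> v \<Longrightarrow> v' \<noteq> - v \<Longrightarrow> f v = f v'"
  shows "finite (f ` V) \<and> card (f ` V) \<le> 2 ^ (DIM('a) + 1) - 2"
proof -
  define \<rho> where "\<rho> v = (SOME v'. v' \<in> V \<and> cong_double M v v')" for v
  have refl: "cong_double M v v" for v
    using discrete_subgroup_zero[OF M] unfolding cong_double_def by force
  have \<rho>: "\<rho> v \<in> V" "cong_double M v (\<rho> v)" if "v \<in> V" for v
    using someI[of "\<lambda>v'. v' \<in> V \<and> cong_double M v v'" v] that refl unfolding \<rho>_def by auto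
  \<comment> \<open>Congruent elements define the same predicate, so the choice operator returns the
    same representative.\<close>
  have \<rho>_eq: "\<rho> v = \<rho> v'" if "cong_double M v v'" for v v'
    unfolding \<rho>_def
    by (rule arg_cong[of _ _ Eps]) (use that cong_double_sym[OF M] cong_double_trans[OF M] in blast)
  define R where "R = \<rho> ` V"
  have RV: "R \<subseteq> V" using \<rho> by (auto simp: R_def)
  have inc: "x = y" if xy: "x \<in> R" "y \<in> R" "cong_double M x y" for x y
  proof -
    obtain v v' where v: "v \<in> V" "x = \<rho> v" "v' \<in> V" "y = \<rho> v'" using xy by (auto simp: R_def)
    have "x = \<rho> v" by (rule v(2))
    also have "\<dots> = \<rho> x" unfolding v(2) by (rule \<rho>_eq[OF \<rho>(2)[OF v(1)]])
    also have "\<dots> = \<rho> y" by (rule \<rho>_eq[OF xy(3)])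
    also have "\<dots> = \<rho> v'" unfolding v(4) by (rule \<rho>_eq[OF \<rho>(2)[OF v(3)], symmetric])
    also have "\<dots> = y" by (rule v(4)[symmetric])
    finally show ?thesis .
  qed
  have 0: "0 \<notin> R" using RV nz refl by blast
  \<comment> \<open>Adding 0 as the representative of the excluded class uses up one of the 2^d
    classes; this is the source of the -2 in the final bound.\<close>
  have "finite (insert 0 R) \<and> card (insert 0 R) \<le> 2 ^ DIM('a)"
  proof (rule card_incongruent[OF M])
    show "insert 0 R \<subseteq> M" using RV V discrete_subgroup_zero[OF M] by auto
    fix x y assume "x \<in> insert 0 R" "y \<in> insert 0 R" "cong_double M x y"
    then show "x = y"
      using inc nz RV cong_double_sym[OF M] by blast
  qed
  then have R: "finite R" "Suc (card R) \<le> 2 ^ DIM('a)" using 0 by auto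
  \<comment> \<open>The vector \<open>- \<rho> v\<close> need not belong to \<open>V\<close>;
    enlarging the image by its value only weakens the upper bound.\<close>
  have sub: "f ` V \<subseteq> f ` R \<union> f ` uminus ` R"
  proof
    fix b assume "b \<in> f ` V"
    then obtain v where v: "v \<in> V" "b = f v" by auto
    have "\<rho> v \<in> R" using v by (auto simp: R_def)
    moreover have "v = \<rho> v \<or> v = - \<rho> v \<or> f v = f (\<rho> v)"
      using eq[of v "\<rho> v"] \<rho>[of v] v(1) by (metis minus_minus)
    ultimately show "b \<in> f ` R \<union> f ` uminus ` R" using v(2) by (metis UnI1 UnI2 imageI)
  qed
  have fin: "finite (f ` R \<union> f ` uminus ` R)" using R by simp
  have "card (f ` V) \<le> card (f ` R \<union> f ` uminus ` R)" by (rule card_mono[OF fin sub])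
  also have "\<dots> \<le> card (f ` R) + card (f ` uminus ` R)" by (rule card_Un_le)
  also have "\<dots> \<le> card R + card R"
    using card_image_le[OF R(1), of f] card_image_le[OF R(1), of "\<lambda>x. f (- x)"]
    unfolding image_image by linarith
  also have "\<dots> \<le> 2 ^ (DIM('a) + 1) - 2" using R(2) by simp
  finally show ?thesis using finite_subset[OF sub fin] by simp
qed

section \<open>Support function and lattice width\<close>

definition supp :: "'a::euclidean_space set \<Rightarrow> 'a \<Rightarrow> real" where
  "supp C u = (SUP x\<in>C. u \<bullet> x)"

lemma bdd_above_inner: "bounded C \<Longrightarrow> bdd_above ((\<lambda>x. u \<bullet> x) ` C)"
  by (metis bounded_imp_bdd_above bounded_linear_image bounded_linear_inner_right)

lemma supp_upper: "bounded C \<Longrightarrow> x \<in> C \<Longrightarrow> u \<bullet> x \<le> supp C u"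
  unfolding supp_def by (rule cSUP_upper[OF _ bdd_above_inner])

lemma supp_least: "C \<noteq> {} \<Longrightarrow> (\<And>x. x \<in> C \<Longrightarrow> u \<bullet> x \<le> r) \<Longrightarrow> supp C u \<le> r"
  unfolding supp_def by (rule cSUP_least)

lemma supp_mono: "bounded D \<Longrightarrow> C \<subseteq> D \<Longrightarrow> C \<noteq> {} \<Longrightarrow> supp C u \<le> supp D u"
  by (rule supp_least) (auto intro: supp_upper)

lemma supp_attained:
  assumes "compact C" "C \<noteq> {}"
  obtains c where "c \<in> C" "u \<bullet> c = supp C u"
proof -
  have "continuous_on C (\<lambda>x. u \<bullet> x)" by (intro continuous_intros)
  then obtain c where c: "c \<in> C" "\<And>x. x \<in> C \<Longrightarrow> u \<bullet> x \<le> u \<bullet> c"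
    using continuous_attains_sup[OF assms] by blast
  have "supp C u = u \<bullet> c"
    using supp_least[of C u "u \<bullet> c"] supp_upper[OF compact_imp_bounded[OF assms(1)] c(1), of u] c(2) assms(2)
    by (intro antisym) auto
  then show ?thesis using that c(1) by simp
qed

text \<open>For nonempty bounded \<open>C\<close> this is the support function of the difference
  body at y. Splitting it into two supports allows a loss of width to be traced to one side.\<close>

definition dwidth :: "'a::euclidean_space set \<Rightarrow> 'a \<Rightarrow> real" where
  "dwidth C y = supp C y + supp C (- y)"

lemma dwidth_ge: "bounded C \<Longrightarrow> a \<in> C \<Longrightarrow> b \<in> C \<Longrightarrow> y \<bullet> (a - b) \<le> dwidth C y"
  using supp_upper[of C a y] supp_upper[of C b "- y"] by (simp add: dwidth_def inner_diff_right)

lemma dwidth_eq_SUP: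
  assumes "compact C" "C \<noteq> {}"
  shows "(SUP p \<in> C \<times> C. y \<bullet> (fst p - snd p)) = dwidth C y"
proof (rule antisym)
  show "(SUP p \<in> C \<times> C. y \<bullet> (fst p - snd p)) \<le> dwidth C y"
    using assms by (intro cSUP_least) (auto intro!: dwidth_ge compact_imp_bounded)
  obtain a where a: "a \<in> C" "y \<bullet> a = supp C y" using supp_attained[OF assms] by metis
  obtain b where b: "b \<in> C" "(-y) \<bullet> b = supp C (-y)" using supp_attained[OF assms] by metis
  have "bdd_above ((\<lambda>p. y \<bullet> (fst p - snd p)) ` (C \<times> C))"
    using assms by (intro bdd_aboveI[of _ "dwidth C y"]) (auto intro!: dwidth_ge compact_imp_bounded)
  then have "y \<bullet> (fst (a, b) - snd (a, b)) \<le> (SUP p \<in> C \<times> C. y \<bullet> (fst p - snd p))"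
    using a b by (intro cSUP_upper) auto
  then show "dwidth C y \<le> (SUP p \<in> C \<times> C. y \<bullet> (fst p - snd p))"
    using a b by (simp add: dwidth_def inner_diff_right)
qed

text \<open>The ball contains two points at distance 2r in direction y. This makes widths of bodies
  positive and bounds the norm of every direction of bounded width.\<close>

lemma dwidth_ge_norm:
  assumes "bounded C" "cball x r \<subseteq> C" "r \<ge> 0"
  shows "2 * r * norm y \<le> dwidth C y"
proof (cases "y = 0")
  case True
  have "x \<in> C" using assms(2,3) by auto
  from dwidth_ge[OF assms(1) this this, of y] True show ?thesis by simp
next
  case False
  define s where "s = (r / norm y) *\<^sub>R y"
  have "norm s = r" using False assms(3) by (simp add: s_def)
  then have "x + s \<in> C" "x - s \<in> C" using assms(2) by (auto simp: subset_iff dist_norm)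
  then have "y \<bullet> ((x + s) - (x - s)) \<le> dwidth C y" by (rule dwidth_ge[OF assms(1)])
  moreover have "y \<bullet> ((x + s) - (x - s)) = 2 * r * norm y"
    using False by (simp add: s_def inner_add_right dot_square_norm power2_eq_square field_simps)
  ultimately show ?thesis by simp
qed

lemma dwidth_nonneg: "bounded C \<Longrightarrow> C \<noteq> {} \<Longrightarrow> 0 \<le> dwidth C y"
  using dwidth_ge[of C _ _ y] by (metis all_not_in_conv cancel_comm_monoid_add_class.diff_cancel inner_zero_right)

lemma convex_body_obtain_cball:
  assumes "convex_body C"
  obtains x r where "r > 0" "cball x r \<subseteq> C"
  using assms unfolding convex_body_def by (metis all_not_in_conv mem_interior_cball)

lemma convex_body_nonempty: "convex_body C \<Longrightarrow> C \<noteq> {}"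
  unfolding convex_body_def by auto

lemma convex_body_bounded: "convex_body C \<Longrightarrow> bounded C"
  unfolding convex_body_def by (auto intro: compact_imp_bounded)

lemma lattice_width_eq_INF:
  assumes "convex_body C"
  shows "lattice_width L C = (INF y \<in> dual_lattice L - {0}. dwidth C y)"
  unfolding lattice_width_def
  using assms dwidth_eq_SUP[of C] convex_body_nonempty[of C] by (simp add: convex_body_def)

lemma bdd_below_dwidth: "convex_body C \<Longrightarrow> bdd_below (dwidth C ` Y)"
  using dwidth_nonneg[OF convex_body_bounded convex_body_nonempty] by (intro bdd_belowI[of _ 0]) auto

lemma lattice_width_le:
  assumes "convex_body C" "y \<in> dual_lattice L" "y \<noteq> 0"
  shows "lattice_width L C \<le> dwidth C y"
  unfolding lattice_width_eq_INF[OF assms(1)]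
  using assms by (intro cINF_lower bdd_below_dwidth) auto

lemma lattice_width_less_obtain:
  assumes "convex_body C" "convex_body D" "D \<subseteq> C" "lattice_width L D \<noteq> lattice_width L C"
  obtains y where "y \<in> dual_lattice L" "y \<noteq> 0" "dwidth D y < lattice_width L C"
proof -
  \<comment> \<open>Over an empty index set both infima would be the same value
    \<open>Inf {}\<close>, so unequal widths rule that out.\<close>
  have ne: "dual_lattice L - {0} \<noteq> {}"
    using assms lattice_width_eq_INF[of C L] lattice_width_eq_INF[of D L] by force
  have mono: "dwidth D y \<le> dwidth C y" for y
    using supp_mono[OF convex_body_bounded[OF assms(1)] assms(3) convex_body_nonempty[OF assms(2)]]
    by (simp add: dwidth_def add_mono)
  have "lattice_width L D \<le> lattice_width L C"
    unfolding lattice_width_eq_INF[OF assms(1)] lattice_width_eq_INF[OF assms(2)]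
    by (intro cINF_mono ne bdd_below_dwidth assms) (use mono in blast)
  then have "(INF y \<in> dual_lattice L - {0}. dwidth D y) < lattice_width L C"
    using assms(4) lattice_width_eq_INF[OF assms(2)] by simp
  then show ?thesis
    using that ne bdd_below_dwidth[OF assms(2)] by (metis (no_types, lifting) cINF_less_iff DiffE insertI1)
qed

lemma full_lattice_discrete_subgroup: "full_lattice L \<Longrightarrow> discrete_subgroup L"
  by (simp add: full_lattice_def discrete_subgroup_def)

text \<open>A nonzero y cannot be orthogonal to a spanning set of lattice vectors, so some basis
  vector b has a nonzero integer product with y, and 1 <= |b| |y| by Cauchy-Schwarz.\<close>

lemma discrete_subgroup_dual_lattice:
  fixes L :: "'a::euclidean_space set"
  assumes "full_lattice L"
  shows "discrete_subgroup (dual_lattice L)"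
proof -
  obtain B where B: "B \<subseteq> L" "independent B" "L \<subseteq> span B"
    using basis_exists[of L] by metis
  have finB: "finite B" using B(2) independent_bound by blast
  have spanB: "span B = UNIV"
    using assms B(3) span_mono[OF B(3)] by (simp add: full_lattice_def span_span top.extremum_unique)
  define K where "K = 1 + (\<Sum>b\<in>B. norm b)"
  have "0 \<le> (\<Sum>b\<in>B. norm b)" by (simp add: sum_nonneg)
  then have K: "K > 0" unfolding K_def by linarith
  have "1 / K \<le> norm y" if y: "y \<in> dual_lattice L" "y \<noteq> 0" for y
  proof -
    have "\<exists>b\<in>B. b \<bullet> y \<noteq> 0"
    proof (rule ccontr)
      assume "\<not> (\<exists>b\<in>B. b \<bullet> y \<noteq> 0)"
      then have "\<And>b. b \<in> B \<Longrightarrow> orthogonal y b" by (simp add: orthogonal_def inner_commute)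
      then have "orthogonal y y" using orthogonal_to_span[of y B y] spanB by auto
      then show False using y by (simp add: orthogonal_def)
    qed
    then obtain b where b: "b \<in> B" "b \<bullet> y \<noteq> 0" by blast
    then have "b \<bullet> y \<in> \<int>" using y(1) B(1) by (auto simp: dual_lattice_def)
    then have "1 \<le> \<bar>b \<bullet> y\<bar>" using Ints_nonzero_abs_ge1 b(2) by blast
    also have "\<dots> \<le> norm b * norm y" by (rule Cauchy_Schwarz_ineq2)
    also have "\<dots> \<le> K * norm y"
      using member_le_sum[OF b(1), of norm] finB by (intro mult_right_mono) (auto simp: K_def)
    finally show ?thesis using K by (simp add: field_simps)
  qed
  moreover have "1 / K > 0" using K by simp
  ultimately show ?thesis
    unfolding discrete_subgroup_def by (auto simp: dual_lattice_def inner_diff_right intro!: exI[of _ "1 / K"])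
qed

section \<open>Vertices of lattice reduced bodies\<close>

text \<open>Extremality makes C minus v convex, so the hull of what remains after removing a small
  ball around v still omits v. The ball is also kept away from a copy of C shrunk by 1 - t towards
  an interior point; that copy survives in D and controls all widths at once.\<close>

lemma extreme_point_cut:
  fixes C :: "'a::euclidean_space set"
  assumes C: "convex_body C" and v: "v extreme_point_of C" and t: "0 < t" "t < 1" and \<epsilon>: "\<epsilon> > 0"
  obtains D where "convex_body D" "D \<subset> C" "C - ball v \<epsilon> \<subseteq> D"
    "\<And>y. (1 - t) * dwidth C y \<le> dwidth D y"
proof -
  obtain x0 r where r: "r > 0" "cball x0 r \<subseteq> C" using convex_body_obtain_cball[OF C] .
  have x0: "x0 \<in> interior C" using r mem_interior_cball by blast
  have cC: "compact C" "convex C" using C by (auto simp: convex_body_def)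
  define K where "K = (\<lambda>x. (1 - t) *\<^sub>R x + t *\<^sub>R x0) ` C"
  have KC: "K \<subseteq> C"
    unfolding K_def using cC(2) t x0 interior_subset[of C] by (auto intro!: convexD[of C])
  \<comment> \<open>A point of \<open>K\<close> lies strictly between a point of C and the interior
    point \<open>x0\<close>, which an extreme point cannot do.\<close>
  have "v \<notin> K"
  proof
    assume "v \<in> K"
    then obtain x where x: "x \<in> C" "v = (1 - t) *\<^sub>R x + t *\<^sub>R x0" by (auto simp: K_def)
    have "v \<noteq> x0" using extreme_point_not_in_interior[OF v] x0 by auto
    then have "x \<noteq> x0" using x(2) by (auto simp: algebra_simps)
    then have "v \<in> open_segment x x0" using x(2) t by (auto simp: in_segment)
    then show False using v x(1) x0 interior_subset unfolding extreme_point_of_def by blast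
  qed
  moreover have "compact K"
    unfolding K_def by (intro compact_continuous_image continuous_intros cC)
  ultimately obtain \<delta>' where \<delta>': "\<delta>' > 0" "ball v \<delta>' \<inter> K = {}"
    by (metis compact_imp_closed open_Compl ComplI open_contains_ball disjoint_eq_subset_Compl)
  define \<delta> where "\<delta> = min \<epsilon> \<delta>'"
  define D where "D = convex hull (C - ball v \<delta>)"
  have KD: "K \<subseteq> D"
  proof
    fix x assume x: "x \<in> K"
    then have "x \<notin> ball v \<delta>'" using \<delta>'(2) by blast
    then have "x \<in> C - ball v \<delta>" using x KC by (auto simp: \<delta>_def)
    then show "x \<in> D" unfolding D_def by (rule hull_inc)
  qed
  have "convex (C - {v})" using v extreme_point_of_stillconvex[OF cC(2)] by blast
  moreover have "C - ball v \<delta> \<subseteq> C - {v}" using \<epsilon> \<delta>' by (auto simp: \<delta>_def)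
  ultimately have DC: "D \<subseteq> C - {v}" unfolding D_def by (rule hull_minimal[rotated])
  have "v \<in> C" using v by (simp add: extreme_point_of_def)
  have "cball x0 ((1 - t) * r) \<subseteq> K"
  proof
    fix y assume y: "y \<in> cball x0 ((1 - t) * r)"
    define x where "x = x0 + (1 / (1 - t)) *\<^sub>R (y - x0)"
    have "dist x0 x = dist x0 y / (1 - t)" using t by (simp add: x_def dist_norm norm_minus_commute)
    also have "\<dots> \<le> r" using y t by (simp add: field_simps)
    finally have "x \<in> C" using r by auto
    moreover have "(1 - t) *\<^sub>R x + t *\<^sub>R x0 = y" using t by (simp add: x_def algebra_simps)
    ultimately show "y \<in> K" unfolding K_def by (metis imageI)
  qed
  moreover have "0 < (1 - t) * r" using t r by simp
  ultimately have "x0 \<in> interior D" using KD by (meson mem_interior_cball subset_trans)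
  moreover have "compact D"
    unfolding D_def by (intro compact_convex_hull compact_diff cC) auto
  ultimately have D: "convex_body D" unfolding convex_body_def D_def by auto
  have "(1 - t) * dwidth C y \<le> dwidth D y" for y
  proof -
    obtain a where a: "a \<in> C" "y \<bullet> a = supp C y"
      using supp_attained[OF cC(1) convex_body_nonempty[OF C]] by metis
    obtain b where b: "b \<in> C" "(-y) \<bullet> b = supp C (-y)"
      using supp_attained[OF cC(1) convex_body_nonempty[OF C]] by metis
    have "(1 - t) *\<^sub>R a + t *\<^sub>R x0 \<in> D" "(1 - t) *\<^sub>R b + t *\<^sub>R x0 \<in> D"
      using a b KD by (auto simp: K_def)
    from dwidth_ge[OF convex_body_bounded[OF D] this, of y]
    have "(1 - t) * (y \<bullet> a - y \<bullet> b) \<le> dwidth D y" by (simp add: algebra_simps)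
    moreover have "dwidth C y = y \<bullet> a - y \<bullet> b" using a(2) b(2) by (simp add: dwidth_def)
    ultimately show ?thesis by simp
  qed
  moreover have "C - ball v \<epsilon> \<subseteq> D"
    using hull_subset[of "C - ball v \<delta>" convex] by (auto simp: D_def \<delta>_def)
  moreover have "D \<subset> C" using DC \<open>v \<in> C\<close> by auto
  ultimately show ?thesis using that D by blast
qed

lemma finite_width_directions:
  assumes "full_lattice L" "convex_body C"
  shows "finite {y \<in> dual_lattice L. dwidth C y \<le> r}"
proof -
  obtain x \<rho> where \<rho>: "\<rho> > 0" "cball x \<rho> \<subseteq> C" using convex_body_obtain_cball[OF assms(2)] .
  have "norm y \<le> r / (2 * \<rho>)" if "dwidth C y \<le> r" for y
    using dwidth_ge_norm[OF convex_body_bounded[OF assms(2)] \<rho>(2), of y] \<rho>(1) that by (simp add: field_simps)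
  then show ?thesis
    by (intro finite_subset[OF _ discrete_subgroup_finite_bounded[OF discrete_subgroup_dual_lattice[OF assms(1)], of "r / (2 * \<rho>)"]]) auto
qed

lemma dwidth_uminus: "dwidth C (- y) = dwidth C y"
  by (simp add: dwidth_def)

text \<open>Cutting off ever smaller caps gives directions whose maximisers are trapped near v and
  whose width is nearly minimal. All of them lie in a finite set, so one direction occurs for
  arbitrarily small caps, and it has both properties exactly.\<close>

lemma reduced_extreme_point_width_direction:
  fixes C :: "'a::euclidean_space set"
  assumes L: "full_lattice L" and red: "lattice_reduced L C" and v: "v extreme_point_of C"
  obtains y where "y \<in> dual_lattice L" "y \<noteq> 0" "dwidth C y = lattice_width L C"
    "{x \<in> C. y \<bullet> x = supp C y} = {v}"
proof -
  have C: "convex_body C" using red by (simp add: lattice_reduced_def)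
  have cC: "compact C" "C \<noteq> {}" using C by (auto simp: convex_body_def)
  let ?w = "lattice_width L C"
  have neg: "- y \<in> dual_lattice L" if "y \<in> dual_lattice L" for y
    using discrete_subgroup_uminus[OF discrete_subgroup_dual_lattice[OF L] that] .
  define Q where "Q n y \<longleftrightarrow> y \<in> dual_lattice L \<and> y \<noteq> 0 \<and> (1 - 1 / real (n + 2)) * dwidth C y < ?w \<and>
      {x \<in> C. y \<bullet> x = supp C y} \<subseteq> ball v (1 / real (n + 1))" for n :: nat and y
  have "\<exists>y. Q n y" for n
  proof -
    \<comment> \<open>The offset 2 keeps t strictly below 1 and at most 1/2 from n = 0 on; the
      latter gives the uniform bound 2w on the widths of the directions.\<close>
    define t where "t = 1 / real (n + 2)"
    have t: "0 < t" "t < 1" by (auto simp: t_def)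
    obtain D where D: "convex_body D" "D \<subset> C" "C - ball v (1 / real (n + 1)) \<subseteq> D"
      "\<And>y. (1 - t) * dwidth C y \<le> dwidth D y"
      using extreme_point_cut[OF C v t, of "1 / real (n + 1)"] by auto
    have "lattice_width L D \<noteq> ?w" using red D unfolding lattice_reduced_def by blast
    then obtain y where y: "y \<in> dual_lattice L" "y \<noteq> 0" "dwidth D y < ?w"
      using lattice_width_less_obtain[OF C D(1)] D(2) by blast
    have "dwidth D y < dwidth C y" using lattice_width_le[OF C y(1,2)] y(3) by linarith
    \<comment> \<open>A drop of the width must occur on one of the two sides; replacing y by -y if
      necessary puts it on the side of y'. Since D keeps everything outside the ball, all maximisers
      of y' on C then lie in the ball.\<close>
    then have "supp D y < supp C y \<or> supp D (-y) < supp C (-y)" unfolding dwidth_def by linarith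
    then obtain y' where y': "y' = y \<or> y' = - y" "supp D y' < supp C y'" by blast
    have "{x \<in> C. y' \<bullet> x = supp C y'} \<subseteq> ball v (1 / real (n + 1))"
      using D(3) supp_upper[OF convex_body_bounded[OF D(1)], of _ y'] y'(2) by fastforce
    moreover have "(1 - t) * dwidth C y' < ?w"
      using D(4)[of y] y(3) y'(1) by (auto simp: dwidth_uminus)
    moreover have "y' \<in> dual_lattice L" "y' \<noteq> 0" using y'(1) y neg by auto
    ultimately show ?thesis unfolding Q_def t_def by blast
  qed
  then obtain Y where Y: "\<And>n. Q n (Y n)" by metis
  have "range Y \<subseteq> {y \<in> dual_lattice L. dwidth C y \<le> 2 * ?w}"
  proof
    fix y assume "y \<in> range Y"
    then obtain n where n: "Q n y" using Y by auto
    have "(1 / 2) * dwidth C y \<le> (1 - 1 / real (n + 2)) * dwidth C y"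
      by (rule mult_right_mono) (auto simp: dwidth_nonneg convex_body_bounded[OF C] cC(2) field_simps)
    also have "\<dots> < ?w" using n by (simp add: Q_def)
    finally have "dwidth C y \<le> 2 * ?w" by linarith
    moreover have "y \<in> dual_lattice L" using n unfolding Q_def by blast
    ultimately show "y \<in> {y \<in> dual_lattice L. dwidth C y \<le> 2 * ?w}" by blast
  qed
  then have "finite (range Y)" using finite_width_directions[OF L C] finite_subset by blast
  then obtain n0 where "infinite {n. Y n = Y n0}"
    using pigeonhole_infinite[of "UNIV :: nat set" Y] by auto
  then have inf: "\<exists>n>N. Y n = Y n0" for N using infinite_nat_iff_unbounded by auto
  define y where "y = Y n0"
  have y: "y \<in> dual_lattice L" "y \<noteq> 0" using Y[of n0] by (auto simp: y_def Q_def)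
  have Qy: "\<exists>n>N. Q n y" for N using inf[of N] Y unfolding y_def by metis
  have "dwidth C y \<le> ?w"
  proof (rule ccontr)
    assume "\<not> dwidth C y \<le> ?w"
    then have less: "?w < dwidth C y" by simp
    then have pos: "dwidth C y - ?w > 0" by simp
    obtain N :: nat where N: "dwidth C y / (dwidth C y - ?w) < real N" using reals_Archimedean2 by blast
    obtain n where n: "n > N" "Q n y" using Qy by blast
    have "dwidth C y < real N * (dwidth C y - ?w)" using N pos by (simp add: field_simps)
    also have "\<dots> \<le> real (n + 2) * (dwidth C y - ?w)" using n(1) pos by (intro mult_right_mono) auto
    finally have "dwidth C y / real (n + 2) < dwidth C y - ?w" by (simp add: field_simps)
    then show False using n(2) by (simp add: Q_def algebra_simps)
  qed
  then have w: "dwidth C y = ?w" using lattice_width_le[OF C y] by simp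
  have "x = v" if x: "x \<in> C" "y \<bullet> x = supp C y" for x
  proof (rule ccontr)
    assume "x \<noteq> v"
    then have pos: "dist v x > 0" by simp
    obtain N :: nat where N: "1 / dist v x < real N" using reals_Archimedean2 by blast
    obtain n where n: "n > N" "Q n y" using Qy by blast
    have "dist v x < 1 / real (n + 1)" using n(2) x by (auto simp: Q_def)
    then have "real (n + 1) < 1 / dist v x" using pos by (simp add: field_simps)
    then show False using N n(1) by linarith
  qed
  moreover obtain c where "c \<in> C" "y \<bullet> c = supp C y" using supp_attained[OF cC] by metis
  ultimately have "{x \<in> C. y \<bullet> x = supp C y} = {v}" by blast
  then show ?thesis using that y w by blast
qed

text \<open>Here one point a, a maximiser for the average direction, turns out to be a maximiser for
  both congruent directions. As their faces are singletons, both name the vertex a.\<close>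

theorem lattice_reduced_vertices:
  fixes C :: "'a::euclidean_space set"
  assumes L: "full_lattice L" and red: "lattice_reduced L C"
  shows "polytope C \<and> card {v. v extreme_point_of C} \<le> 2 ^ (DIM('a) + 1) - 2"
proof -
  have C: "convex_body C" using red by (simp add: lattice_reduced_def)
  have cC: "compact C" "convex C" "C \<noteq> {}" using C by (auto simp: convex_body_def)
  have disc: "discrete_subgroup (dual_lattice L)" by (rule discrete_subgroup_dual_lattice[OF L])
  let ?w = "lattice_width L C"
  define F where "F y = {x \<in> C. y \<bullet> x = supp C y}" for y
  define V where "V = {y \<in> dual_lattice L. y \<noteq> 0 \<and> dwidth C y = ?w \<and> is_singleton (F y)}"
  define f where "f y = the_elem (F y)" for y
  obtain x0 r where r: "r > 0" "cball x0 r \<subseteq> C" using convex_body_obtain_cball[OF C] .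
  have fin: "finite (f ` V) \<and> card (f ` V) \<le> 2 ^ (DIM('a) + 1) - 2"
  proof (rule card_image_nonzero_classes[OF disc])
    show "V \<subseteq> dual_lattice L" by (auto simp: V_def)
  next
    fix y assume y: "y \<in> V"
    show "\<not> cong_double (dual_lattice L) y 0"
    proof
      assume "cong_double (dual_lattice L) y 0"
      then obtain z where z: "z \<in> dual_lattice L" "y = z + z" unfolding cong_double_def by auto
      have z0: "z \<noteq> 0" using y z(2) by (auto simp: V_def)
      obtain a where a: "a \<in> C" "z \<bullet> a = supp C z" using supp_attained[OF cC(1,3)] by metis
      obtain b where b: "b \<in> C" "(-z) \<bullet> b = supp C (-z)" using supp_attained[OF cC(1,3)] by metis
      \<comment> \<open>Halving y would halve the minimal width, and a nonzero dual vector cannot do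
        that.\<close>
      have "2 * dwidth C z = y \<bullet> (a - b)"
        using z(2) by (simp add: dwidth_def algebra_simps flip: a(2) b(2))
      also have "\<dots> \<le> dwidth C y" by (rule dwidth_ge[OF convex_body_bounded[OF C] a(1) b(1)])
      also have "\<dots> \<le> dwidth C z" using y lattice_width_le[OF C z(1) z0] by (simp add: V_def)
      finally have "dwidth C z \<le> 0" by simp
      moreover have "0 < 2 * r * norm z" using r z0 by simp
      ultimately show False using dwidth_ge_norm[OF convex_body_bounded[OF C] r(2), of z] r(1) by linarith
    qed
  next
    fix y y' assume y: "y \<in> V" "y' \<in> V" and cong: "cong_double (dual_lattice L) y y'"
      and ne: "y' \<noteq> y" "y' \<noteq> - y"
    obtain z where z: "z \<in> dual_lattice L" "y - y' = z + z" using cong unfolding cong_double_def by auto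
    define m where "m = y - z"
    have m: "m \<in> dual_lattice L"
      using discrete_subgroup_diff[OF disc _ z(1)] y(1) by (auto simp: m_def V_def)
    have m2: "m + m = y + y'" using z(2) by (simp add: m_def algebra_simps)
    have m0: "m \<noteq> 0" using m2 ne(2) by (metis add_0 add.commute minus_unique)
    obtain a where a: "a \<in> C" "m \<bullet> a = supp C m" using supp_attained[OF cC(1,3)] by metis
    obtain b where b: "b \<in> C" "(-m) \<bullet> b = supp C (-m)" using supp_attained[OF cC(1,3)] by metis
    have "2 * ?w \<le> 2 * dwidth C m" using lattice_width_le[OF C m m0] by simp
    also have "\<dots> = (m + m) \<bullet> (a - b)" by (simp add: dwidth_def algebra_simps flip: a(2) b(2))
    also have "\<dots> = (y \<bullet> a + (-y) \<bullet> b) + (y' \<bullet> a + (-y') \<bullet> b)"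
      unfolding m2 by (simp add: algebra_simps)
    finally have *: "2 * ?w \<le> (y \<bullet> a + (-y) \<bullet> b) + (y' \<bullet> a + (-y') \<bullet> b)" .
    have w: "supp C y + supp C (-y) = ?w" "supp C y' + supp C (-y') = ?w"
      using y by (auto simp: V_def dwidth_def)
    note su = supp_upper[OF convex_body_bounded[OF C] a(1)] supp_upper[OF convex_body_bounded[OF C] b(1)]
    \<comment> \<open>The four supports add up to exactly 2w, the lower bound in \<open>*\<close>,
      so none of the four support inequalities can be strict.\<close>
    have "y \<bullet> a = supp C y" "y' \<bullet> a = supp C y'"
      using * w su(1)[of y] su(1)[of y'] su(2)[of "-y"] su(2)[of "-y'"] by linarith+
    then have "a \<in> F y" "a \<in> F y'" using a by (auto simp: F_def)
    then have "F y = {a}" "F y' = {a}" using y by (auto simp: V_def is_singleton_def)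
    then show "f y = f y'" by (simp add: f_def)
  qed
  have sub: "{v. v extreme_point_of C} \<subseteq> f ` V"
  proof
    fix v assume "v \<in> {v. v extreme_point_of C}"
    then obtain y where "y \<in> dual_lattice L" "y \<noteq> 0" "dwidth C y = ?w" "F y = {v}"
      using reduced_extreme_point_width_direction[OF L red, of v] unfolding F_def by blast
    then have "y \<in> V" "f y = v" by (auto simp: V_def f_def)
    then show "v \<in> f ` V" by blast
  qed
  have "finite {v. v extreme_point_of C}" using finite_subset[OF sub] fin by blast
  then have "polytope C"
    using Krein_Milman_Minkowski[OF cC(1,2)] unfolding polytope_def by metis
  moreover have "card {v. v extreme_point_of C} \<le> 2 ^ (DIM('a) + 1) - 2"
    using card_mono[OF _ sub] fin by linarith
  ultimately show ?thesis by blast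
qed

section \<open>Lattice diameter\<close>

text \<open>The generator is t u with t the least positive number such that t u is in L; division
  with remainder shows that it generates. This justifies the definite description in
  \<open>lattice_gen\<close>.\<close>

lemma lattice_gen_spec:
  assumes L: "full_lattice L" and w: "w \<in> L" "w \<noteq> 0" "w = s *\<^sub>R u"
  shows "lattice_gen L u \<in> L \<and> (\<exists>t>0. lattice_gen L u = t *\<^sub>R u) \<and>
    (\<forall>x\<in>L. (\<exists>s. x = s *\<^sub>R u) \<longrightarrow> (\<exists>k::int. x = of_int k *\<^sub>R lattice_gen L u))"
proof -
  have disc: "discrete_subgroup L" by (rule full_lattice_discrete_subgroup[OF L])
  have u: "u \<noteq> 0" and s: "s \<noteq> 0" using w by auto
  \<comment> \<open>The known multiple |s| is a cutoff: below it discreteness leaves only finitely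
    many candidates, so a minimum exists.\<close>
  define T where "T = {t. 0 < t \<and> t \<le> \<bar>s\<bar> \<and> t *\<^sub>R u \<in> L}"
  have "(\<lambda>t. t *\<^sub>R u) ` T \<subseteq> {x \<in> L. norm x \<le> \<bar>s\<bar> * norm u}"
    by (auto simp: T_def intro!: mult_right_mono)
  then have "finite ((\<lambda>t. t *\<^sub>R u) ` T)"
    using discrete_subgroup_finite_bounded[OF disc] finite_subset by blast
  then have finT: "finite T"
    by (rule finite_imageD) (use u in \<open>auto intro: inj_onI\<close>)
  have "\<bar>s\<bar> *\<^sub>R u \<in> L"
    using w discrete_subgroup_uminus[OF disc w(1)] by (cases "s \<ge> 0") auto
  then have "\<bar>s\<bar> \<in> T" using s by (simp add: T_def)
  define t where "t = Min T"
  have tT: "t \<in> T" unfolding t_def using finT \<open>\<bar>s\<bar> \<in> T\<close> by (intro Min_in) auto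
  have tmin: "t \<le> t'" if "0 < t'" "t' *\<^sub>R u \<in> L" for t'
  proof (cases "t' \<le> \<bar>s\<bar>")
    case True
    then have "t' \<in> T" using that by (simp add: T_def)
    then show ?thesis using finT by (simp add: t_def)
  next
    case False
    then show ?thesis using tT by (simp add: T_def)
  qed
  have t: "0 < t" "t *\<^sub>R u \<in> L" using tT by (auto simp: T_def)
  have mult: "\<exists>k::int. x = of_int k *\<^sub>R (t *\<^sub>R u)" if "x \<in> L" "x = r *\<^sub>R u" for x r
  proof -
    define k where "k = \<lfloor>r / t\<rfloor>"
    have "of_int k \<le> r / t" "r / t < of_int k + 1" unfolding k_def by linarith+
    then have k: "of_int k * t \<le> r" "r < of_int k * t + t" using t(1) by (auto simp: field_simps)
    have "(r - of_int k * t) *\<^sub>R u \<in> L"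
      using discrete_subgroup_diff[OF disc that(1) discrete_subgroup_of_int_scaleR[OF disc t(2), of k]] that(2)
      by (simp add: algebra_simps)
    then have "r = of_int k * t" using tmin[of "r - of_int k * t"] k by force
    then show ?thesis using that(2) by auto
  qed
  let ?P = "\<lambda>v. v \<in> L \<and> (\<exists>t>0. v = t *\<^sub>R u) \<and>
      (\<forall>w\<in>L. (\<exists>s. w = s *\<^sub>R u) \<longrightarrow> (\<exists>k::int. w = of_int k *\<^sub>R v))"
  have P: "?P (t *\<^sub>R u)" using t mult by blast
  have uniq: "v = t *\<^sub>R u" if v: "?P v" for v
  proof -
    obtain r where r: "r > 0" "v = r *\<^sub>R u" using v by blast
    obtain k :: int where k: "v = of_int k *\<^sub>R (t *\<^sub>R u)" using mult[of v r] v r by blast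
    obtain l :: int where l: "t *\<^sub>R u = of_int l *\<^sub>R v" using v t(2) by blast
    have eqs: "r = of_int k * t" "t = of_int l * r" using k l r(2) u by simp_all
    have "0 < of_int k * t" "0 < of_int l * r" using r(1) t(1) unfolding eqs(1,2)[symmetric] .
    then have kl: "k > 0" "l > 0" using r(1) t(1) by (simp_all add: zero_less_mult_iff)
    have "of_int (k * l) * t = t" using eqs by (metis mult.assoc mult.commute of_int_mult)
    then have "real_of_int (k * l) = 1" using t(1) by simp
    then have "k * l = 1" by linarith
    then have "k = 1" using kl(1) zmult_eq_1_iff[of k l] by linarith
    then show ?thesis using k by simp
  qed
  have "lattice_gen L u = t *\<^sub>R u"
    unfolding lattice_gen_def by (rule the_equality[where P="?P", OF P uniq])
  then show ?thesis using P by simp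
qed

text \<open>The quotient of norms becomes the coefficient of b - a with respect to a lattice vector,
  so later arguments are linear.\<close>

lemma lattice_length_spec:
  assumes L: "full_lattice L" and ab: "a \<noteq> b" "lattice_segment L a b"
  obtains g where "g \<in> L" "g \<noteq> 0" "b - a = lattice_length L a b *\<^sub>R g"
    "lattice_length L a b = norm (b - a) / norm g"
    "\<And>w s. w \<in> L \<Longrightarrow> w = s *\<^sub>R (b - a) \<Longrightarrow> \<exists>k::int. w = of_int k *\<^sub>R g"
proof -
  obtain w t where w: "w \<in> L" "w \<noteq> 0" "b - a = t *\<^sub>R w" using ab(2) unfolding lattice_segment_def by blast
  have "t \<noteq> 0" using w(3) ab(1) by auto
  then have "w = (1 / t) *\<^sub>R (b - a)" using w(3) by simp
  note spec = lattice_gen_spec[OF L w(1,2) this]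
  obtain r where r: "r > 0" "lattice_gen L (b - a) = r *\<^sub>R (b - a)" using spec by blast
  show ?thesis
  proof (rule that[of "lattice_gen L (b - a)"])
    show "lattice_gen L (b - a) \<in> L" using spec by blast
    show "lattice_gen L (b - a) \<noteq> 0" using r ab by simp
    show "lattice_length L a b = norm (b - a) / norm (lattice_gen L (b - a))" by (rule lattice_length_def)
    show "b - a = lattice_length L a b *\<^sub>R lattice_gen L (b - a)"
      using r ab by (simp add: lattice_length_def)
    show "\<exists>k::int. w = of_int k *\<^sub>R lattice_gen L (b - a)" if "w \<in> L" "w = s *\<^sub>R (b - a)" for w s
      using spec that by blast
  qed
qed

lemma lattice_diam_least:
  assumes L: "full_lattice L" and "0 \<le> r"
    and le: "\<And>v p q s. v \<in> L \<Longrightarrow> v \<noteq> 0 \<Longrightarrow> p \<in> C \<Longrightarrow> q \<in> C \<Longrightarrow> q - p = s *\<^sub>R v \<Longrightarrow> s \<le> r"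
  shows "lattice_diam L C \<le> r"
  unfolding lattice_diam_def
proof (rule cSup_least)
  fix x assume "x \<in> {0} \<union> {lattice_length L a b | a b.
      a \<in> C \<and> b \<in> C \<and> a \<noteq> b \<and> closed_segment a b \<subseteq> C \<and> lattice_segment L a b}"
  then consider "x = 0" | a b where "x = lattice_length L a b" "a \<in> C" "b \<in> C" "a \<noteq> b" "lattice_segment L a b"
    by blast
  then show "x \<le> r"
  proof cases
    case 2
    then show ?thesis using lattice_length_spec[OF L 2(4,5)] le by metis
  qed (use assms in simp)
qed simp

text \<open>The vector v need not be primitive: v = k g with g the generator and k >= 1, so s is at
  most s k, the true lattice length. Together with \<open>lattice_diam_least\<close> this presents
  the diameter as the largest s with s v in the difference body for some nonzero lattice vector
  v.\<close>

lemma lattice_diam_upper: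
  assumes L: "full_lattice L" and C: "convex_body C"
    and v: "v \<in> L" "v \<noteq> 0" and pq: "p \<in> C" "q \<in> C" "q - p = s *\<^sub>R v"
  shows "s \<le> lattice_diam L C"
proof -
  let ?S = "{0} \<union> {lattice_length L a b | a b.
      a \<in> C \<and> b \<in> C \<and> a \<noteq> b \<and> closed_segment a b \<subseteq> C \<and> lattice_segment L a b}"
  obtain e where e: "e > 0" "\<And>x. x \<in> L \<Longrightarrow> x \<noteq> 0 \<Longrightarrow> e \<le> norm x"
    using L unfolding full_lattice_def by blast
  have bC: "bounded C" by (rule convex_body_bounded[OF C])
  \<comment> \<open>Generators have norm at least e, so lattice lengths are at most the Euclidean
    diameter divided by e.\<close>
  have "bdd_above ?S"
  proof (rule bdd_aboveI)
    fix x assume "x \<in> ?S"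
    then consider "x = 0" | a b where "x = lattice_length L a b" "a \<in> C" "b \<in> C" "a \<noteq> b" "lattice_segment L a b"
      by blast
    then show "x \<le> diameter C / e"
    proof cases
      case 1
      then show ?thesis using e diameter_ge_0[OF bC] by simp
    next
      case 2
      obtain g where g: "g \<in> L" "g \<noteq> 0" "x = norm (b - a) / norm g"
        using lattice_length_spec[OF L 2(4,5)] 2(1) by metis
      have "norm (b - a) \<le> diameter C"
        using diameter_bounded_bound[OF bC 2(3,2)] by (simp add: dist_norm)
      then show ?thesis unfolding g(3) using e g diameter_ge_0[OF bC] by (intro frac_le) auto
    qed
  qed
  then have up: "x \<le> lattice_diam L C" if "x \<in> ?S" for x
    unfolding lattice_diam_def by (rule cSup_upper[OF that])
  show ?thesis
  proof (cases "s > 0")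
    case True
    then have ne: "p \<noteq> q" using pq v by auto
    have seg: "lattice_segment L p q" unfolding lattice_segment_def using pq v by blast
    have "closed_segment p q \<subseteq> C" using C pq by (simp add: convex_body_def closed_segment_subset)
    then have "lattice_length L p q \<in> ?S" using pq ne seg by blast
    then have le: "lattice_length L p q \<le> lattice_diam L C" by (rule up)
    obtain g where g: "g \<in> L" "g \<noteq> 0" "q - p = lattice_length L p q *\<^sub>R g"
      "\<And>w s. w \<in> L \<Longrightarrow> w = s *\<^sub>R (q - p) \<Longrightarrow> \<exists>k::int. w = of_int k *\<^sub>R g"
      using lattice_length_spec[OF L ne seg] by metis
    have "v = (1 / s) *\<^sub>R (q - p)" using pq(3) True by simp
    then obtain k :: int where k: "v = of_int k *\<^sub>R g" using g(4)[OF v(1)] by blast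
    have len0: "0 \<le> lattice_length L p q" unfolding lattice_length_def by simp
    have eq: "lattice_length L p q = s * of_int k" using g(2,3) pq(3) k by simp
    then have "k \<ge> 0" using len0 True by (simp add: zero_le_mult_iff)
    moreover have "k \<noteq> 0" using k v by auto
    ultimately have "s * 1 \<le> s * of_int k" using True by (intro mult_left_mono) auto
    then show ?thesis using le eq by simp
  next
    case False
    then show ?thesis using up[of 0] by simp
  qed
qed

lemma full_lattice_nonzero:
  fixes L :: "'a::euclidean_space set"
  assumes "full_lattice L"
  obtains v where "v \<in> L" "v \<noteq> 0"
proof -
  have "\<not> L \<subseteq> {0}"
  proof
    assume "L \<subseteq> {0}"
    then have "(UNIV :: 'a set) \<subseteq> span {0}" using assms span_mono[of L "{0}"] by (simp add: full_lattice_def)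
    moreover obtain b :: 'a where "b \<in> Basis" using nonempty_Basis by blast
    ultimately show False using nonzero_Basis by auto
  qed
  then show ?thesis using that by blast
qed

lemma lattice_diam_pos:
  assumes L: "full_lattice L" and C: "convex_body C"
  shows "lattice_diam L C > 0"
proof -
  obtain v where v: "v \<in> L" "v \<noteq> 0" using full_lattice_nonzero[OF L] .
  obtain x r where r: "r > 0" "cball x r \<subseteq> C" using convex_body_obtain_cball[OF C] .
  have "x \<in> C" "x + (r / norm v) *\<^sub>R v \<in> C" using r v by (auto simp: subset_iff dist_norm)
  from lattice_diam_upper[OF L C v this, of "r / norm v"] have "r / norm v \<le> lattice_diam L C" by simp
  moreover have "r / norm v > 0" using r v by simp
  ultimately show ?thesis by linarith
qed

lemma lattice_diam_mono:
  assumes "full_lattice L" "convex_body C'" "C \<subseteq> C'"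
  shows "lattice_diam L C \<le> lattice_diam L C'"
proof (rule lattice_diam_least[OF assms(1)])
  show "0 \<le> lattice_diam L C'" using lattice_diam_pos[OF assms(1,2)] by simp
  show "s \<le> lattice_diam L C'"
    if "v \<in> L" "v \<noteq> 0" "p \<in> C" "q \<in> C" "q - p = s *\<^sub>R v" for v p q s
    using lattice_diam_upper[OF assms(1,2) that(1,2) _ _ that(5)] that(3,4) assms(3) by blast
qed

section \<open>Facets of lattice complete bodies\<close>

definition differences :: "'a::euclidean_space set \<Rightarrow> 'a set" where
  "differences C = (\<Union>x\<in>C. \<Union>y\<in>C. {x - y})"

lemma convex_body_differences:
  assumes "convex_body C"
  shows "convex (differences C)" "closed (differences C)"
  using assms unfolding differences_def convex_body_def
  by (simp_all only: convex_differences compact_imp_closed compact_differences')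

lemma supporting_hyperplane_frontier_point:
  fixes S :: "'a::euclidean_space set"
  assumes "convex S" "x \<in> S" "x \<notin> interior S"
  obtains a where "a \<noteq> 0" "\<And>y. y \<in> S \<Longrightarrow> a \<bullet> x \<le> a \<bullet> y"
proof (cases "interior S = {}")
  case True
  then obtain a b where a: "a \<noteq> 0" "S \<subseteq> {x. a \<bullet> x = b}"
    using empty_interior_subset_hyperplane[OF assms(1)] by metis
  have "a \<bullet> x \<le> a \<bullet> y" if "y \<in> S" for y
    using subsetD[OF a(2) assms(2)] subsetD[OF a(2) that] by simp
  then show ?thesis by (rule that[OF a(1)])
next
  case False
  then have "x \<notin> rel_interior S" using rel_interior_nonempty_interior assms(3) by blast
  then obtain a where "a \<noteq> 0" "\<And>y. y \<in> S \<Longrightarrow> a \<bullet> x \<le> a \<bullet> y"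
    using supporting_hyperplane_rel_boundary[OF assms(1,2)] by metis
  then show ?thesis by (rule that)
qed

lemma dwidth_le_inner:
  assumes "compact C" "C \<noteq> {}" "\<And>d. d \<in> differences C \<Longrightarrow> u \<bullet> d \<le> r"
  shows "dwidth C u \<le> r"
proof -
  obtain a where a: "a \<in> C" "u \<bullet> a = supp C u" using supp_attained[OF assms(1,2)] by metis
  obtain b where b: "b \<in> C" "(-u) \<bullet> b = supp C (-u)" using supp_attained[OF assms(1,2)] by metis
  have "dwidth C u = u \<bullet> (a - b)" by (simp add: dwidth_def inner_diff_right flip: a(2) b(2))
  moreover have "a - b \<in> differences C" using a(1) b(1) by (auto simp: differences_def)
  ultimately show ?thesis using assms(3) by simp
qed

lemma dwidth_less_inner_obtain:
  assumes C: "convex_body C" and x: "x \<notin> differences C"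
  obtains u where "dwidth C u < u \<bullet> x"
proof -
  have cC: "compact C" "convex C" "C \<noteq> {}" using C by (auto simp: convex_body_def)
  obtain a b where ab: "a \<bullet> x < b" "\<And>d. d \<in> differences C \<Longrightarrow> a \<bullet> d > b"
    using separating_hyperplane_closed_point[OF convex_body_differences[OF C] x] by blast
  have "dwidth C (-a) \<le> - b"
    by (rule dwidth_le_inner[OF cC(1,3)]) (use ab(2) in force)
  then show ?thesis using that[of "-a"] ab(1) by simp
qed

text \<open>The hypothesis places x on or beyond the boundary of the difference body along its ray.
  Beyond, strict separation applies; on the boundary, a supporting hyperplane. Either functional is
  then normalised.\<close>

lemma dwidth_le_inner_obtain:
  assumes C: "convex_body C" and x: "x \<noteq> 0" "\<And>s. s *\<^sub>R x \<in> differences C \<Longrightarrow> s \<le> 1"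
  obtains u where "norm u = 1" "dwidth C u \<le> u \<bullet> x"
proof -
  have cC: "compact C" "convex C" "C \<noteq> {}" using C by (auto simp: convex_body_def)
  show ?thesis
  proof (cases "x \<in> differences C")
    case False
    then obtain u where u: "dwidth C u < u \<bullet> x" using dwidth_less_inner_obtain[OF C] by blast
    have "u \<noteq> 0" using u dwidth_nonneg[OF convex_body_bounded[OF C] cC(3), of u] by auto
    moreover have "dwidth C ((1 / norm u) *\<^sub>R u) \<le> (1 / norm u) * dwidth C u"
    proof (rule dwidth_le_inner[OF cC(1,3)])
      fix d assume "d \<in> differences C"
      then have "u \<bullet> d \<le> dwidth C u" using dwidth_ge[OF convex_body_bounded[OF C]] by (auto simp: differences_def)
      then show "((1 / norm u) *\<^sub>R u) \<bullet> d \<le> (1 / norm u) * dwidth C u"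
        by (simp add: divide_right_mono)
    qed
    moreover have "(1 / norm u) * dwidth C u \<le> ((1 / norm u) *\<^sub>R u) \<bullet> x"
      using u by (simp add: divide_right_mono)
    ultimately show ?thesis using that[of "(1 / norm u) *\<^sub>R u"] by simp
  next
    case True
    have "x \<notin> interior (differences C)"
    proof
      assume "x \<in> interior (differences C)"
      then obtain e where e: "e > 0" "cball x e \<subseteq> differences C" using mem_interior_cball by blast
      have "dist x ((1 + e / norm x) *\<^sub>R x) = e" using x(1) e(1) by (simp add: dist_norm algebra_simps)
      then have "(1 + e / norm x) *\<^sub>R x \<in> differences C" using e(2) by auto
      then show False using x(2)[of "1 + e / norm x"] x(1) e(1) by (simp add: field_simps)
    qed
    then obtain a where a: "a \<noteq> 0" "\<And>y. y \<in> differences C \<Longrightarrow> a \<bullet> x \<le> a \<bullet> y"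
      using supporting_hyperplane_frontier_point[OF convex_body_differences(1)[OF C] True] by blast
    define u where "u = - ((1 / norm a) *\<^sub>R a)"
    have "dwidth C u \<le> u \<bullet> x"
    proof (rule dwidth_le_inner[OF cC(1,3)])
      fix d assume "d \<in> differences C"
      then have "a \<bullet> x \<le> a \<bullet> d" by (rule a(2))
      then show "u \<bullet> d \<le> u \<bullet> x" by (simp add: u_def divide_right_mono)
    qed
    moreover have "norm u = 1" using a(1) by (simp add: u_def)
    ultimately show ?thesis using that by blast
  qed
qed

text \<open>A boundary point that touches a ball contained in \<open>C\<close> has a unique normal.\<close>
lemma smooth_boundary_point_obtain:
  fixes C :: "'a::euclidean_space set"
  assumes C: "convex_body C" and W: "open W" "z0 \<in> W" "z0 \<in> frontier C"
  obtains z w where "z \<in> W" "z \<in> C" "norm w = 1" "w \<bullet> z = supp C w"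
    "\<And>a. norm a = 1 \<Longrightarrow> a \<bullet> z = supp C a \<Longrightarrow> a = w"
proof -
  have cC: "compact C" "convex C" "C \<noteq> {}" "interior C \<noteq> {}" using C by (auto simp: convex_body_def)
  have bC: "bounded C" and clC: "closed C" using cC(1) by (auto intro: compact_imp_bounded compact_imp_closed)
  have frC: "frontier C \<subseteq> C" using clC by (simp add: frontier_subset_closed)
  obtain \<rho> where \<rho>: "\<rho> > 0" "ball z0 \<rho> \<subseteq> W" using W open_contains_ball by blast
  have "z0 \<in> closure (interior C)"
    using convex_closure_interior[OF cC(2,4)] frC W(3) closure_subset by blast
  then obtain c where c: "c \<in> interior C" "dist c z0 < \<rho> / 2"
    unfolding closure_approachable using \<rho> by (meson half_gt_zero)
  \<comment> \<open>The nearest frontier point z stays within \<rho> of \<open>z0\<close>, and no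
    frontier point is closer to c, so by connectedness the ball around c touching z lies in
    C.\<close>
  obtain z where z: "z \<in> frontier C" "\<And>y. y \<in> frontier C \<Longrightarrow> dist c z \<le> dist c y"
    using distance_attains_inf[of "frontier C" c] W(3) by (metis frontier_closed empty_iff)
  have "dist z0 z \<le> dist c z0 + dist c z" by (metis dist_commute dist_triangle)
  also have "\<dots> < \<rho>" using c(2) z(2)[OF W(3)] by linarith
  finally have zW: "z \<in> W" using \<rho> by auto
  define r where "r = dist c z"
  have "z \<notin> interior C" using z(1) by (simp add: frontier_def)
  then have r: "r > 0" using c(1) unfolding r_def by auto
  have "ball c r \<subseteq> C"
  proof (rule ccontr)
    assume "\<not> ball c r \<subseteq> C"
    moreover have "c \<in> ball c r \<inter> C" using r c(1) interior_subset[of C] by auto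
    ultimately have "ball c r \<inter> frontier C \<noteq> {}"
      by (intro connected_Int_frontier) blast+
    then show False using z(2) by (fastforce simp: r_def)
  qed
  then have cb: "cball c r \<subseteq> C"
    using clC r by (metis closure_ball closure_minimal)
  define w where "w = (1 / r) *\<^sub>R (z - c)"
  have rn: "norm (z - c) = r" by (simp add: r_def dist_norm norm_minus_commute)
  have nw: "norm w = 1" using r by (simp add: w_def rn)
  have uniq: "a = w" if a: "norm a = 1" "a \<bullet> z = supp C a" for a
  proof -
    \<comment> \<open>Testing the normal a at the point of the ball farthest in direction a gives a
      . w >= 1, which for unit vectors forces a = w.\<close>
    have "c + r *\<^sub>R a \<in> C" using cb a(1) r by (auto simp: subset_iff dist_norm)
    then have "a \<bullet> (c + r *\<^sub>R a) \<le> a \<bullet> z" using supp_upper[OF bC] a(2) by simp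
    moreover have "a \<bullet> a = 1" using a(1) by (simp add: dot_square_norm)
    ultimately have "r \<le> a \<bullet> (z - c)" by (simp add: algebra_simps)
    then have "1 \<le> a \<bullet> w" using r by (simp add: w_def)
    moreover have "w \<bullet> w = 1" using nw by (simp add: dot_square_norm)
    moreover have "(a - w) \<bullet> (a - w) = a \<bullet> a - 2 * (a \<bullet> w) + w \<bullet> w"
      by (simp add: inner_diff_left inner_diff_right inner_commute)
    ultimately have "(a - w) \<bullet> (a - w) \<le> 0"
      using \<open>a \<bullet> a = 1\<close> by linarith
    then show ?thesis by (metis eq_iff_diff_eq_0 inner_ge_zero inner_eq_zero_iff order_antisym)
  qed
  obtain a where a: "a \<noteq> 0" "\<And>y. y \<in> C \<Longrightarrow> a \<bullet> z \<le> a \<bullet> y"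
    using supporting_hyperplane_frontier_point[OF cC(2) _ \<open>z \<notin> interior C\<close>] frC z(1) by blast
  define b where "b = - ((1 / norm a) *\<^sub>R a)"
  have nb: "norm b = 1" using a(1) by (simp add: b_def)
  have "supp C b \<le> b \<bullet> z"
    by (rule supp_least[OF cC(3)]) (use a(2) in \<open>auto simp: b_def divide_right_mono\<close>)
  moreover have "b \<bullet> z \<le> supp C b" using frC z(1) by (intro supp_upper[OF bC]) auto
  ultimately have "b \<bullet> z = supp C b" by simp
  moreover from uniq[OF nb this] have "b = w" .
  ultimately show ?thesis using that[OF zW _ nw _ uniq] frC z(1) by blast
qed

definition diametral :: "'a::euclidean_space set \<Rightarrow> 'a set \<Rightarrow> 'a set" where
  "diametral L C = {v \<in> L. v \<noteq> 0 \<and> lattice_diam L C *\<^sub>R v \<in> differences C}"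

text \<open>For diametral v these are the unit outer normals of the difference body at the diametral
  point. Asking only for an inequality makes sense for every lattice vector, as is needed for an
  average not yet known to be diametral.\<close>

definition diametral_normals :: "'a::euclidean_space set \<Rightarrow> 'a set \<Rightarrow> 'a \<Rightarrow> 'a set" where
  "diametral_normals L C v = {u. norm u = 1 \<and> dwidth C u \<le> lattice_diam L C * (u \<bullet> v)}"

definition smooth_diametral :: "'a::euclidean_space set \<Rightarrow> 'a set \<Rightarrow> 'a set" where
  "smooth_diametral L C = {v \<in> diametral L C. is_singleton (diametral_normals L C v)}"

definition diametral_normal :: "'a::euclidean_space set \<Rightarrow> 'a set \<Rightarrow> 'a \<Rightarrow> 'a" where
  "diametral_normal L C v = the_elem (diametral_normals L C v)"

lemma smooth_diametral_normals:
  assumes "v \<in> smooth_diametral L C"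
  shows "diametral_normals L C v = {diametral_normal L C v}"
proof -
  obtain u where "diametral_normals L C v = {u}"
    using assms by (auto simp: smooth_diametral_def is_singleton_def)
  then show ?thesis by (simp add: diametral_normal_def)
qed

lemma norm_diametral_normal:
  assumes "v \<in> smooth_diametral L C"
  shows "norm (diametral_normal L C v) = 1"
proof -
  have "diametral_normal L C v \<in> diametral_normals L C v" unfolding smooth_diametral_normals[OF assms] by simp
  then show ?thesis unfolding diametral_normals_def by simp
qed

lemma inner_le_dwidth:
  "bounded C \<Longrightarrow> d \<in> differences C \<Longrightarrow> u \<bullet> d \<le> dwidth C u"
  using dwidth_ge by (auto simp: differences_def)

lemma lattice_diam_upper_differences:
  assumes "full_lattice L" "convex_body C" "v \<in> L" "v \<noteq> 0" "s *\<^sub>R v \<in> differences C"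
  shows "s \<le> lattice_diam L C"
proof -
  obtain p q where "p \<in> C" "q \<in> C" "q - p = s *\<^sub>R v" using assms(5) unfolding differences_def by force
  then show ?thesis using lattice_diam_upper[OF assms(1-4)] by blast
qed

lemma diametral_normals_nonempty:
  assumes L: "full_lattice L" and C: "convex_body C" and v: "v \<in> L" "v \<noteq> 0"
  shows "diametral_normals L C v \<noteq> {}"
proof -
  have pos: "lattice_diam L C > 0" by (rule lattice_diam_pos[OF L C])
  have "s \<le> 1" if "s *\<^sub>R (lattice_diam L C *\<^sub>R v) \<in> differences C" for s
    using lattice_diam_upper_differences[OF L C v, of "s * lattice_diam L C"] that pos by simp
  then obtain u where "norm u = 1" "dwidth C u \<le> u \<bullet> (lattice_diam L C *\<^sub>R v)"
    using dwidth_le_inner_obtain[OF C, of "lattice_diam L C *\<^sub>R v"] pos v by auto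
  then show ?thesis unfolding diametral_normals_def by auto
qed

text \<open>In contrast to the width argument, one functional now serves two vectors: a normal u for
  the average m satisfies both support inequalities, at v and at v', with equality. Uniqueness at v
  and at v' identifies both normals with u.\<close>

lemma diametral_normal_card:
  fixes C :: "'a::euclidean_space set"
  assumes L: "full_lattice L" and C: "convex_body C"
  shows "finite (diametral_normal L C ` smooth_diametral L C) \<and>
    card (diametral_normal L C ` smooth_diametral L C) \<le> 2 ^ (DIM('a) + 1) - 2"
proof (rule card_image_nonzero_classes[OF full_lattice_discrete_subgroup[OF L]])
  let ?\<delta> = "lattice_diam L C"
  have pos: "?\<delta> > 0" by (rule lattice_diam_pos[OF L C])
  have bC: "bounded C" by (rule convex_body_bounded[OF C])
  show "smooth_diametral L C \<subseteq> L" by (auto simp: smooth_diametral_def diametral_def)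
  show "\<not> cong_double L v 0" if v: "v \<in> smooth_diametral L C" for v
  proof
    assume "cong_double L v 0"
    then obtain z where z: "z \<in> L" "v = z + z" unfolding cong_double_def by auto
    have "?\<delta> *\<^sub>R v \<in> differences C" "z \<noteq> 0" using v z(2) by (auto simp: smooth_diametral_def diametral_def)
    moreover have "?\<delta> *\<^sub>R v = (2 * ?\<delta>) *\<^sub>R z" using z(2) by (simp flip: scaleR_2)
    ultimately have "2 * ?\<delta> \<le> ?\<delta>" using lattice_diam_upper_differences[OF L C z(1)] by simp
    then show False using pos by simp
  qed
  fix v v' assume v: "v \<in> smooth_diametral L C" "v' \<in> smooth_diametral L C"
    and cong: "cong_double L v v'" and ne: "v' \<noteq> v" "v' \<noteq> - v"
  obtain z where z: "z \<in> L" "v - v' = z + z" using cong unfolding cong_double_def by auto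
  define m where "m = v - z"
  have m: "m \<in> L"
    using discrete_subgroup_diff[OF full_lattice_discrete_subgroup[OF L] _ z(1)] v(1)
    by (auto simp: m_def smooth_diametral_def diametral_def)
  have m2: "m + m = v + v'" using z(2) by (simp add: m_def algebra_simps)
  have m0: "m \<noteq> 0" using m2 ne(2) by (metis add_0 add.commute minus_unique)
  obtain u where u: "norm u = 1" "dwidth C u \<le> ?\<delta> * (u \<bullet> m)"
    using diametral_normals_nonempty[OF L C m m0] by (auto simp: diametral_normals_def)
  have "u \<bullet> (?\<delta> *\<^sub>R v) \<le> dwidth C u" "u \<bullet> (?\<delta> *\<^sub>R v') \<le> dwidth C u"
    using v by (auto intro!: inner_le_dwidth[OF bC] simp del: inner_scaleR_right simp: smooth_diametral_def diametral_def)
  moreover have "2 * (?\<delta> * (u \<bullet> m)) = ?\<delta> * (u \<bullet> (m + m))" by (simp add: algebra_simps)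
  then have "2 * (?\<delta> * (u \<bullet> m)) = ?\<delta> * (u \<bullet> v) + ?\<delta> * (u \<bullet> v')" unfolding m2 by (simp add: algebra_simps)
  ultimately have "u \<in> diametral_normals L C v" "u \<in> diametral_normals L C v'"
    using u by (auto simp: diametral_normals_def)
  then have "diametral_normals L C v = {u}" "diametral_normals L C v' = {u}"
    using v by (auto simp: smooth_diametral_def is_singleton_def)
  then show "diametral_normal L C v = diametral_normal L C v'" by (simp add: diametral_normal_def)
qed

text \<open>If every lattice direction has a supporting slab of \<open>C\<close> that certifies the diameter and contains
  \<open>z\<close> in its interior, a point close to \<open>z\<close> can be added; only finitely many directions are
  relevant, so one distance works for all of them.\<close>
lemma lattice_diam_insert:
  fixes C :: "'a::euclidean_space set"
  assumes L: "full_lattice L" and C: "convex_body C"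
    and slab: "\<And>v. v \<in> L \<Longrightarrow> v \<noteq> 0 \<Longrightarrow> \<exists>u \<alpha> \<beta>. \<alpha> - \<beta> \<le> lattice_diam L C * (u \<bullet> v) \<and> 0 < u \<bullet> v \<and>
      (\<forall>c\<in>C. \<beta> \<le> u \<bullet> c \<and> u \<bullet> c \<le> \<alpha>) \<and> \<beta> < u \<bullet> z \<and> u \<bullet> z < \<alpha>"
  obtains \<epsilon> where "\<epsilon> > 0" "lattice_diam L (convex hull (insert (z + \<epsilon> *\<^sub>R w) C)) = lattice_diam L C"
proof -
  let ?\<delta> = "lattice_diam L C"
  have pos: "?\<delta> > 0" by (rule lattice_diam_pos[OF L C])
  obtain R where R: "R > 0" "\<And>x. x \<in> C \<Longrightarrow> norm x \<le> R"
    using convex_body_bounded[OF C] unfolding bounded_pos by auto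
  \<comment> \<open>For \<epsilon> < 1 the enlarged body stays in the ball of radius
    \<open>K\<close>, so a difference longer than the old diameter is possible only along the
    finitely many vectors in \<open>V\<close>.\<close>
  define K where "K = R + norm z + norm w"
  define V where "V = {v \<in> L. norm v \<le> 2 * K / ?\<delta>} - {0}"
  have finV: "finite V"
    unfolding V_def using discrete_subgroup_finite_bounded[OF full_lattice_discrete_subgroup[OF L]] by blast
  define Q where "Q \<epsilon> v \<longleftrightarrow> (\<exists>u \<alpha> \<beta>. \<alpha> - \<beta> \<le> ?\<delta> * (u \<bullet> v) \<and> 0 < u \<bullet> v \<and>
      (\<forall>c\<in>insert (z + \<epsilon> *\<^sub>R w) C. \<beta> \<le> u \<bullet> c \<and> u \<bullet> c \<le> \<alpha>))" for \<epsilon> v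
  have "eventually (\<lambda>\<epsilon>. Q \<epsilon> v) (at_right 0)" if v: "v \<in> V" for v
  proof -
    obtain u \<alpha> \<beta> where u: "\<alpha> - \<beta> \<le> ?\<delta> * (u \<bullet> v)" "0 < u \<bullet> v"
      "\<forall>c\<in>C. \<beta> \<le> u \<bullet> c \<and> u \<bullet> c \<le> \<alpha>" "\<beta> < u \<bullet> z" "u \<bullet> z < \<alpha>"
      using slab[of v] v by (auto simp: V_def)
    have "((\<lambda>\<epsilon>. u \<bullet> (z + \<epsilon> *\<^sub>R w)) \<longlongrightarrow> u \<bullet> (z + 0 *\<^sub>R w)) (at_right 0)"
      by (intro tendsto_intros)
    then have lim: "((\<lambda>\<epsilon>. u \<bullet> (z + \<epsilon> *\<^sub>R w)) \<longlongrightarrow> u \<bullet> z) (at_right 0)" by simp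
    have "eventually (\<lambda>\<epsilon>. \<beta> < u \<bullet> (z + \<epsilon> *\<^sub>R w)) (at_right 0)" "eventually (\<lambda>\<epsilon>. u \<bullet> (z + \<epsilon> *\<^sub>R w) < \<alpha>) (at_right 0)"
      using order_tendstoD[OF lim] u(4,5) by auto
    then show ?thesis
    proof eventually_elim
      case (elim \<epsilon>)
      have "\<forall>c\<in>insert (z + \<epsilon> *\<^sub>R w) C. \<beta> \<le> u \<bullet> c \<and> u \<bullet> c \<le> \<alpha>" using elim u(3) by auto
      then show ?case unfolding Q_def using u(1,2) by blast
    qed
  qed
  then have "eventually (\<lambda>\<epsilon>. \<forall>v\<in>V. Q \<epsilon> v) (at_right 0)"
    using finV by (simp add: eventually_ball_finite)
  moreover have "eventually (\<lambda>\<epsilon>::real. \<epsilon> \<in> {0<..<1}) (at_right 0)" by (rule eventually_at_right_real) simp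
  ultimately have "eventually (\<lambda>\<epsilon>. (\<forall>v\<in>V. Q \<epsilon> v) \<and> \<epsilon> \<in> {0<..<1}) (at_right (0::real))"
    by (rule eventually_conj)
  then obtain \<epsilon> :: real where \<epsilon>: "\<forall>v\<in>V. Q \<epsilon> v" "0 < \<epsilon>" "\<epsilon> < 1"
    using eventually_happens'[OF trivial_limit_at_right_real] by (metis (no_types, lifting) greaterThanLessThan_iff)
  define X where "X = insert (z + \<epsilon> *\<^sub>R w) C"
  have cC: "compact C" "convex C" using C by (auto simp: convex_body_def)
  have X: "convex_body (convex hull X)"
    unfolding convex_body_def
  proof (intro conjI)
    show "compact (convex hull X)" unfolding X_def by (intro compact_convex_hull compact_insert cC)
    have "C \<subseteq> convex hull X" using hull_subset[of X convex] by (auto simp: X_def)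
    then show "interior (convex hull X) \<noteq> {}" using C interior_mono unfolding convex_body_def by blast
  qed simp
  have "norm (z + \<epsilon> *\<^sub>R w) \<le> norm z + \<epsilon> * norm w" using norm_triangle_ineq[of z "\<epsilon> *\<^sub>R w"] \<epsilon> by simp
  moreover have "\<epsilon> * norm w \<le> 1 * norm w" using \<epsilon> by (intro mult_right_mono) auto
  ultimately have nz: "norm (z + \<epsilon> *\<^sub>R w) \<le> K" using R(1) by (simp add: K_def)
  have "norm x \<le> K" if "x \<in> C" for x
    using R(2)[OF that] norm_ge_zero[of z] norm_ge_zero[of w] unfolding K_def by linarith
  then have "X \<subseteq> cball 0 K" using nz by (auto simp: X_def)
  then have bX: "convex hull X \<subseteq> cball 0 K" by (intro hull_minimal) auto
  have "lattice_diam L (convex hull X) \<le> ?\<delta>"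
  proof (rule lattice_diam_least[OF L])
    fix v p q s
    assume v: "v \<in> L" "v \<noteq> 0" and pq: "p \<in> convex hull X" "q \<in> convex hull X" "q - p = s *\<^sub>R v"
    show "s \<le> ?\<delta>"
    proof (rule ccontr)
      assume "\<not> s \<le> ?\<delta>"
      then have s: "?\<delta> < s" by simp
      have "norm p \<le> K" "norm q \<le> K" using bX pq(1,2) by auto
      then have "norm (q - p) \<le> 2 * K" using norm_triangle_ineq4[of q p] by linarith
      then have "s * norm v \<le> 2 * K" using s pos pq(3) by simp
      moreover have "?\<delta> * norm v \<le> s * norm v" using s by (intro mult_right_mono) auto
      ultimately have "norm v * ?\<delta> \<le> 2 * K" by (simp add: mult.commute)
      then have "v \<in> V" using v pos by (simp add: V_def pos_le_divide_eq)
      then obtain u \<alpha> \<beta> where u: "\<alpha> - \<beta> \<le> ?\<delta> * (u \<bullet> v)" "0 < u \<bullet> v"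
        "\<forall>c\<in>X. \<beta> \<le> u \<bullet> c \<and> u \<bullet> c \<le> \<alpha>" using \<epsilon>(1) unfolding Q_def X_def by blast
      have "convex hull X \<subseteq> {x. u \<bullet> x \<ge> \<beta>} \<inter> {x. u \<bullet> x \<le> \<alpha>}"
        by (intro hull_minimal convex_Int convex_halfspace_ge convex_halfspace_le) (use u(3) in auto)
      then have "\<beta> \<le> u \<bullet> p" "u \<bullet> q \<le> \<alpha>" using pq by auto
      then have "u \<bullet> (q - p) \<le> ?\<delta> * (u \<bullet> v)" using u(1) by (simp add: inner_diff_right)
      then have "s * (u \<bullet> v) \<le> ?\<delta> * (u \<bullet> v)" using pq(3) by simp
      then show False using u(2) s by simp
    qed
  qed (use pos in simp)
  moreover have "?\<delta> \<le> lattice_diam L (convex hull X)"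
    by (rule lattice_diam_mono[OF L X]) (use hull_subset[of X convex] in \<open>auto simp: X_def\<close>)
  ultimately show ?thesis using that[of \<epsilon>] \<epsilon> by (simp add: X_def)
qed

text \<open>The difference body is symmetric. This puts both sides of a slab among the constraints:
  staying strictly inside the halfspaces for u and for -u keeps a point off both faces.\<close>

lemma uminus_smooth_diametral:
  assumes L: "full_lattice L" and v: "v \<in> smooth_diametral L C" "diametral_normals L C v = {u}"
  shows "- v \<in> smooth_diametral L C" "diametral_normals L C (- v) = {- u}"
proof -
  have *: "diametral_normals L C (- v) = uminus ` diametral_normals L C v"
  proof (intro set_eqI iffI)
    fix a assume "a \<in> diametral_normals L C (- v)"
    then have "- a \<in> diametral_normals L C v" by (simp add: diametral_normals_def dwidth_uminus)
    then show "a \<in> uminus ` diametral_normals L C v" by (metis image_eqI minus_minus)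
  qed (auto simp: diametral_normals_def dwidth_uminus)
  then show n: "diametral_normals L C (- v) = {- u}" using v(2) by simp
  have "- v \<in> L" using v(1) discrete_subgroup_uminus[OF full_lattice_discrete_subgroup[OF L]]
    by (auto simp: smooth_diametral_def diametral_def)
  moreover have "lattice_diam L C *\<^sub>R (- v) \<in> differences C"
  proof -
    obtain p q where "p \<in> C" "q \<in> C" "lattice_diam L C *\<^sub>R v = p - q"
      using v(1) by (auto simp: smooth_diametral_def diametral_def differences_def)
    then have "lattice_diam L C *\<^sub>R (- v) = q - p" by (simp add: algebra_simps)
    then show ?thesis using \<open>p \<in> C\<close> \<open>q \<in> C\<close> unfolding differences_def by blast
  qed
  ultimately show "- v \<in> smooth_diametral L C"
    using v(1) n by (auto simp: smooth_diametral_def diametral_def)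
qed

text \<open>If the halfspaces cut out more than C, the frontier has a point where none of them is
  tight. A nearby smooth point then admits a suitable slab for every lattice vector, so C can grow
  there without changing its diameter.\<close>

lemma lattice_complete_eq_halfspaces:
  fixes C :: "'a::euclidean_space set"
  assumes L: "full_lattice L" and compl: "lattice_complete L C"
  shows "C = {x. \<forall>u \<in> diametral_normal L C ` smooth_diametral L C. u \<bullet> x \<le> supp C u}"
proof (rule ccontr)
  have C: "convex_body C" using compl by (simp add: lattice_complete_def)
  have cC: "compact C" "convex C" "C \<noteq> {}" "interior C \<noteq> {}" using C by (auto simp: convex_body_def)
  have bC: "bounded C" by (rule convex_body_bounded[OF C])
  let ?\<delta> = "lattice_diam L C"
  have pos: "?\<delta> > 0" by (rule lattice_diam_pos[OF L C])
  define U where "U = diametral_normal L C ` smooth_diametral L C"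
  have finU: "finite U" using diametral_normal_card[OF L C] by (simp add: U_def)
  define W where "W = {x. \<forall>u\<in>U. u \<bullet> x < supp C u}"
  have nU: "norm u = 1" if "u \<in> U" for u
    using that norm_diametral_normal by (auto simp: U_def)
  assume "C \<noteq> {x. \<forall>u \<in> diametral_normal L C ` smooth_diametral L C. u \<bullet> x \<le> supp C u}"
  then obtain x0 where x0: "x0 \<notin> C" "\<And>u. u \<in> U \<Longrightarrow> u \<bullet> x0 \<le> supp C u"
    using supp_upper[OF bC] by (auto simp: U_def)
  have openW: "open W"
  proof -
    have "W = (\<Inter>u\<in>U. {x. u \<bullet> x < supp C u})" by (auto simp: W_def)
    then show ?thesis using finU by (simp add: open_halfspace_lt open_INT)
  qed
  obtain y0 r where y0: "r > 0" "cball y0 r \<subseteq> C" using convex_body_obtain_cball[OF C] .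
  have y0C: "y0 \<in> C" using y0 by auto
  have y0W: "u \<bullet> y0 < supp C u" if "u \<in> U" for u
  proof -
    have "y0 + r *\<^sub>R u \<in> C" using y0 nU[OF that] by (auto simp: subset_iff dist_norm)
    then have "u \<bullet> (y0 + r *\<^sub>R u) \<le> supp C u" by (rule supp_upper[OF bC])
    moreover have "u \<bullet> u = 1" using nU[OF that] by (simp add: dot_square_norm)
    ultimately show ?thesis using y0(1) by (simp add: inner_add_right)
  qed
  have "closed_segment y0 x0 \<inter> frontier C \<noteq> {}"
    by (rule connected_Int_frontier) (use y0C x0(1) in auto)
  then obtain z0 where z0: "z0 \<in> closed_segment y0 x0" "z0 \<in> frontier C" by blast
  have "z0 \<in> C" using z0(2) frontier_subset_closed[OF compact_imp_closed[OF cC(1)]] by blast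
  obtain t where t: "0 \<le> t" "t \<le> 1" "z0 = (1 - t) *\<^sub>R y0 + t *\<^sub>R x0" using z0(1) by (auto simp: in_segment)
  have "t \<noteq> 1" using t(3) \<open>z0 \<in> C\<close> x0(1) by auto
  then have t1: "t < 1" using t by simp
  have "z0 \<in> W"
  proof -
    have "u \<bullet> z0 < supp C u" if "u \<in> U" for u
    proof -
      have "u \<bullet> z0 = (1 - t) * (u \<bullet> y0) + t * (u \<bullet> x0)" using t(3) by (simp add: inner_add_right)
      also have "\<dots> < (1 - t) * supp C u + t * supp C u"
        using y0W[OF that] x0(2)[OF that] t t1 by (intro add_less_le_mono mult_strict_left_mono mult_left_mono) auto
      finally show ?thesis by (simp add: algebra_simps)
    qed
    then show ?thesis by (simp add: W_def)
  qed
  then obtain z w where z: "z \<in> W" "z \<in> C" "norm w = 1" "w \<bullet> z = supp C w"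
    and uniq: "\<And>a. norm a = 1 \<Longrightarrow> a \<bullet> z = supp C a \<Longrightarrow> a = w"
    using smooth_boundary_point_obtain[OF C openW _ z0(2)] by metis
  have slab: "\<exists>u \<alpha> \<beta>. \<alpha> - \<beta> \<le> ?\<delta> * (u \<bullet> v) \<and> 0 < u \<bullet> v \<and>
      (\<forall>c\<in>C. \<beta> \<le> u \<bullet> c \<and> u \<bullet> c \<le> \<alpha>) \<and> \<beta> < u \<bullet> z \<and> u \<bullet> z < \<alpha>" if v: "v \<in> L" "v \<noteq> 0" for v
  proof (cases "?\<delta> *\<^sub>R v \<in> differences C")
    case False
    then obtain u where u: "dwidth C u < u \<bullet> (?\<delta> *\<^sub>R v)" using dwidth_less_inner_obtain[OF C] by blast
    \<comment> \<open>Half the surplus of the strict separation: widening the supporting slab by it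
      on both sides uses up the surplus and leaves every point of C strictly inside.\<close>
    define \<eta> where "\<eta> = (?\<delta> * (u \<bullet> v) - dwidth C u) / 2"
    have \<eta>: "\<eta> > 0" using u by (simp add: \<eta>_def)
    have "0 < ?\<delta> * (u \<bullet> v)" using u dwidth_nonneg[OF bC cC(3), of u] by simp
    then have "0 < u \<bullet> v" using pos by (simp add: zero_less_mult_iff)
    moreover have "(supp C u + \<eta>) - (- supp C (-u) - \<eta>) \<le> ?\<delta> * (u \<bullet> v)"
      by (simp add: \<eta>_def dwidth_def field_simps)
    moreover have bnd: "- supp C (-u) - \<eta> < u \<bullet> c" "u \<bullet> c < supp C u + \<eta>" if "c \<in> C" for c
      using supp_upper[OF bC that, of u] supp_upper[OF bC that, of "-u"] \<eta> by simp_all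
    ultimately show ?thesis
      using z(2) by (intro exI[of _ u] exI[of _ "supp C u + \<eta>"] exI[of _ "- supp C (-u) - \<eta>"] conjI ballI)
        (auto intro: less_imp_le)
  next
    case True
    then have vd: "v \<in> diametral L C" using v by (simp add: diametral_def)
    have pos': "u \<bullet> v > 0" if "u \<in> diametral_normals L C v" for u
    proof -
      have "2 * r * norm u \<le> dwidth C u" by (rule dwidth_ge_norm[OF bC y0(2)]) (use y0 in simp)
      then have "0 < ?\<delta> * (u \<bullet> v)" using that y0(1) by (auto simp: diametral_normals_def)
      then show ?thesis using pos by (simp add: zero_less_mult_iff)
    qed
    have "\<exists>u \<in> diametral_normals L C v. u \<bullet> z < supp C u \<and> (-u) \<bullet> z < supp C (-u)"
    proof (cases "is_singleton (diametral_normals L C v)")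
      case True
      then obtain u where u: "diametral_normals L C v = {u}" by (auto simp: is_singleton_def)
      have sv: "v \<in> smooth_diametral L C" using vd True by (simp add: smooth_diametral_def)
      have "diametral_normal L C v = u" "diametral_normal L C (- v) = - u"
        using u uminus_smooth_diametral(2)[OF L sv u] by (simp_all add: diametral_normal_def)
      then have "u \<in> U" "- u \<in> U"
        using imageI[OF sv, of "diametral_normal L C"]
          imageI[OF uminus_smooth_diametral(1)[OF L sv u], of "diametral_normal L C"]
        unfolding U_def by simp_all
      then have "u \<bullet> z < supp C u" "(-u) \<bullet> z < supp C (-u)" using z(1) unfolding W_def by blast+
      then show ?thesis unfolding u by blast
    next
      case False
      obtain u1 where u1: "u1 \<in> diametral_normals L C v" using diametral_normals_nonempty[OF L C v] by blast
      then obtain u2 where u2: "u2 \<in> diametral_normals L C v" "u2 \<noteq> u1"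
        using False unfolding is_singleton_def by blast
      \<comment> \<open>Both normals pair positively with v, so they are not opposite; being
        distinct, they cannot both lie in {w, -w}. The other one supports C at z on neither side, as
        w is the only normal there.\<close>
      have "\<not> (u1 = w \<and> u2 = - w)" "\<not> (u1 = - w \<and> u2 = w)"
        using pos'[OF u1] pos'[OF u2(1)] by auto
      then have "\<exists>u \<in> diametral_normals L C v. u \<noteq> w \<and> u \<noteq> - w" using u1 u2 by metis
      then obtain u where u: "u \<in> diametral_normals L C v" "u \<noteq> w" "u \<noteq> - w" by blast
      have "norm u = 1" using u(1) by (simp add: diametral_normals_def)
      then have "u \<bullet> z \<noteq> supp C u" "(-u) \<bullet> z \<noteq> supp C (-u)"
        using uniq[of u] uniq[of "-u"] u(2,3) by auto
      then have "u \<bullet> z < supp C u" "(-u) \<bullet> z < supp C (-u)"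
        using supp_upper[OF bC z(2), of u] supp_upper[OF bC z(2), of "-u"] by linarith+
      then show ?thesis using u(1) by blast
    qed
    then obtain u where u: "u \<in> diametral_normals L C v" "u \<bullet> z < supp C u" "(-u) \<bullet> z < supp C (-u)" by blast
    have "- supp C (-u) \<le> u \<bullet> c \<and> u \<bullet> c \<le> supp C u" if "c \<in> C" for c
      using supp_upper[OF bC that, of u] supp_upper[OF bC that, of "-u"] by simp
    moreover have "supp C u - (- supp C (-u)) \<le> ?\<delta> * (u \<bullet> v)"
      using u(1) by (simp add: diametral_normals_def dwidth_def)
    moreover have "- supp C (-u) < u \<bullet> z" using u(3) by simp
    ultimately show ?thesis
      using u(2) pos'[OF u(1)] by (intro exI[of _ u] exI[of _ "supp C u"] exI[of _ "- supp C (-u)"]) simp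
  qed
  obtain \<epsilon> where \<epsilon>: "\<epsilon> > 0" "lattice_diam L (convex hull (insert (z + \<epsilon> *\<^sub>R w) C)) = ?\<delta>"
    using lattice_diam_insert[OF L C slab] by blast
  let ?X = "convex hull (insert (z + \<epsilon> *\<^sub>R w) C)"
  have sub: "insert (z + \<epsilon> *\<^sub>R w) C \<subseteq> ?X" by (rule hull_subset)
  have "w \<bullet> (z + \<epsilon> *\<^sub>R w) > supp C w" using z(3,4) \<epsilon>(1) by (simp add: inner_add_right dot_square_norm)
  then have "z + \<epsilon> *\<^sub>R w \<notin> C" using supp_upper[OF bC] by (meson not_le)
  then have "C \<subset> ?X" using sub by blast
  moreover have "convex_body ?X"
    unfolding convex_body_def
  proof (intro conjI)
    show "compact ?X" by (intro compact_convex_hull compact_insert cC)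
    show "interior ?X \<noteq> {}" using cC(4) sub interior_mono[of C ?X] by blast
  qed simp
  ultimately show False using compl \<epsilon>(2) unfolding lattice_complete_def by blast
qed

text \<open>A relative interior point of a facet F makes some constraint tight. The face cut out by
  that constraint contains F and is proper, so it has the same dimension as F and equals it.\<close>

lemma halfspaces_polytope_facets:
  fixes C :: "'a::euclidean_space set"
  assumes C: "convex_body C" and U: "finite U" "0 \<notin> U" "C = {x. \<forall>u\<in>U. u \<bullet> x \<le> b u}"
  shows "polytope C \<and> {F. F facet_of C} \<subseteq> (\<lambda>u. C \<inter> {x. u \<bullet> x = b u}) ` U"
proof
  have cvx: "convex C" using C by (simp add: convex_body_def)
  have "C = \<Inter> ((\<lambda>u. {x. u \<bullet> x \<le> b u}) ` U)" using U(3) by auto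
  moreover have "polyhedron (\<Inter> ((\<lambda>u. {x. u \<bullet> x \<le> b u}) ` U))"
    using U(1) by (intro polyhedron_Inter) (auto simp: polyhedron_halfspace_le)
  ultimately show "polytope C"
    using convex_body_bounded[OF C] by (simp add: polytope_eq_bounded_polyhedron)
  show "{F. F facet_of C} \<subseteq> (\<lambda>u. C \<inter> {x. u \<bullet> x = b u}) ` U"
  proof
    fix F assume "F \<in> {F. F facet_of C}"
    then have F: "F face_of C" "F \<noteq> {}" "aff_dim F = aff_dim C - 1" by (auto simp: facet_of_def)
    have "convex F" by (rule face_of_imp_convex[OF F(1)])
    then obtain z where z: "z \<in> rel_interior F" using F(2) rel_interior_eq_empty by blast
    have zC: "z \<in> C" using z rel_interior_subset face_of_imp_subset[OF F(1)] by blast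
    have FC: "F \<noteq> C" using F(3) by auto
    have "\<exists>u\<in>U. u \<bullet> z = b u"
    proof (rule ccontr)
      assume "\<not> (\<exists>u\<in>U. u \<bullet> z = b u)"
      then have "z \<in> (\<Inter>u\<in>U. {x. u \<bullet> x < b u})" using zC U(3) by (auto simp: order_less_le)
      moreover have "open (\<Inter>u\<in>U. {x. u \<bullet> x < b u})" using U(1) by (auto intro!: open_INT open_halfspace_lt)
      moreover have "(\<Inter>u\<in>U. {x. u \<bullet> x < b u}) \<subseteq> C" using U(3) by (auto intro: less_imp_le)
      ultimately have "z \<in> interior C" by (meson interior_maximal subsetD)
      then have "z \<in> rel_interior C" using interior_subset_rel_interior by blast
      then have "F = C"
        using face_of_disjoint_rel_interior[OF F(1) FC] z rel_interior_subset by blast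
      then show False using FC by simp
    qed
    then obtain u where u: "u \<in> U" "u \<bullet> z = b u" by blast
    define G where "G = C \<inter> {x. u \<bullet> x = b u}"
    have G: "G face_of C"
      unfolding G_def using u(1) U(3) by (intro face_of_Int_supporting_hyperplane_le[OF cvx]) auto
    have FG: "F \<subseteq> G"
      by (rule subset_of_face_of[OF G face_of_imp_subset[OF F(1)]]) (use z zC u in \<open>auto simp: G_def\<close>)
    have "u \<noteq> 0" using u(1) U(2) by auto
    then have "interior {x. u \<bullet> x = b u} = {}" by simp
    then have GC: "G \<noteq> C"
      using C interior_mono[of C "{x. u \<bullet> x = b u}"] unfolding G_def convex_body_def by blast
    have "aff_dim G < aff_dim C" by (rule face_of_aff_dim_lt[OF cvx G GC])
    then have "aff_dim G = aff_dim F" using F(3) aff_dim_subset[OF FG] by simp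
    moreover have "F face_of G" by (rule face_of_subset[OF F(1) FG]) (auto simp: G_def)
    ultimately have "F = G"
      using face_of_aff_dim_lt[of G F] face_of_imp_convex[OF G] by fastforce
    then show "F \<in> (\<lambda>u. C \<inter> {x. u \<bullet> x = b u}) ` U" using u(1) by (auto simp: G_def)
  qed
qed

theorem lattice_complete_facets:
  fixes C :: "'a::euclidean_space set"
  assumes L: "full_lattice L" and compl: "lattice_complete L C"
  shows "polytope C \<and> card {F. F facet_of C} \<le> 2 ^ (DIM('a) + 1) - 2"
proof -
  have C: "convex_body C" using compl by (simp add: lattice_complete_def)
  let ?U = "diametral_normal L C ` smooth_diametral L C"
  have U: "finite ?U" "card ?U \<le> 2 ^ (DIM('a) + 1) - 2" using diametral_normal_card[OF L C] by auto
  have "norm u = 1" if "u \<in> ?U" for u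
    using that norm_diametral_normal by auto
  then have U0: "0 \<notin> ?U" by fastforce
  note fac = halfspaces_polytope_facets[OF C U(1) U0 lattice_complete_eq_halfspaces[OF L compl]]
  have "card {F. F facet_of C} \<le> card ((\<lambda>u. C \<inter> {x. u \<bullet> x = supp C u}) ` ?U)"
    by (rule card_mono) (use fac U(1) in auto)
  also have "\<dots> \<le> card ?U" by (rule card_image_le[OF U(1)])
  finally show ?thesis using fac U(2) by simp
qed

section \<open>Extremal examples\<close>

definition int_lattice :: "'a::euclidean_space set" where
  "int_lattice = {x. \<forall>i\<in>Basis. x \<bullet> i \<in> \<int>}"

lemma sum_Basis_in_int_lattice: "S \<subseteq> Basis \<Longrightarrow> \<Sum>S \<in> int_lattice"
  by (auto simp: int_lattice_def inner_sum_left inner_Basis intro!: Ints_sum)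

lemma full_lattice_int_lattice: "full_lattice (int_lattice :: 'a::euclidean_space set)"
  unfolding full_lattice_def
proof (intro conjI ballI exI[of _ 1] impI)
  fix x :: 'a assume x: "x \<in> int_lattice" "x \<noteq> 0"
  then obtain i where i: "i \<in> Basis" "x \<bullet> i \<noteq> 0" using euclidean_all_zero_iff[of x] by auto
  then have "1 \<le> \<bar>x \<bullet> i\<bar>" using x(1) by (auto simp: int_lattice_def intro!: Ints_nonzero_abs_ge1)
  also have "\<dots> \<le> norm x" by (rule Basis_le_norm[OF i(1)])
  finally show "1 \<le> norm x" .
next
  have "(Basis :: 'a set) \<subseteq> int_lattice" by (auto simp: int_lattice_def inner_Basis)
  then have "span Basis \<subseteq> span (int_lattice :: 'a set)" by (rule span_mono)
  then show "span (int_lattice :: 'a set) = UNIV" by (simp add: top.extremum_unique)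
qed (auto simp: int_lattice_def inner_diff_left)

lemma dual_lattice_int_lattice: "dual_lattice (int_lattice :: 'a::euclidean_space set) = int_lattice"
proof (intro set_eqI iffI)
  fix y :: 'a assume "y \<in> dual_lattice int_lattice"
  moreover have "(Basis :: 'a set) \<subseteq> int_lattice" by (auto simp: int_lattice_def inner_Basis)
  ultimately show "y \<in> int_lattice" by (auto simp: dual_lattice_def int_lattice_def inner_commute)
next
  fix y :: 'a assume y: "y \<in> int_lattice"
  have "x \<bullet> y \<in> \<int>" if "x \<in> int_lattice" for x :: 'a
    using that y unfolding int_lattice_def by (subst euclidean_inner) (auto intro!: Ints_sum Ints_mult)
  then show "y \<in> dual_lattice int_lattice" by (auto simp: dual_lattice_def)
qed

text \<open>The negative weight is small enough that every integer vector \<open>w\<close> satisfies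
  \<open>weight_vector S \<bullet> w \<ge> 1\<close> for \<open>S\<close> the set of its positive coordinates, while among the vectors
  \<open>\<plusminus>\<Sum>T\<close> the value 1 is attained only at \<open>\<Sum>S\<close>.\<close>
definition weight_vector :: "'a::euclidean_space set \<Rightarrow> 'a" where
  "weight_vector S = (1 / card S) *\<^sub>R (\<Sum>S - (1 / DIM('a)) *\<^sub>R \<Sum>(Basis - S))"

lemma inner_weight_vector:
  fixes w :: "'a::euclidean_space"
  shows "weight_vector S \<bullet> w = ((\<Sum>i\<in>S. w \<bullet> i) - (\<Sum>i\<in>Basis - S. w \<bullet> i) / DIM('a)) / card S"
  by (simp add: weight_vector_def inner_diff_left inner_sum_left inner_commute[of w] divide_inverse mult.commute)

lemma inner_weight_vector_sum:
  fixes S T :: "'a::euclidean_space set"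
  assumes "S \<subseteq> Basis" "T \<subseteq> Basis"
  shows "weight_vector S \<bullet> \<Sum>T = (card (S \<inter> T) - card (T - S) / DIM('a)) / card S"
proof -
  have fin: "finite S" "finite T" using assms by (auto intro: finite_subset)
  have ind: "\<Sum>T \<bullet> i = (if i \<in> T then 1 else 0)" if i: "i \<in> Basis" for i
  proof -
    have "\<Sum>T \<bullet> i = (\<Sum>j\<in>T. if j = i then 1 else 0)"
      unfolding inner_sum_left by (rule sum.cong) (use assms(2) i in \<open>auto simp: inner_Basis\<close>)
    then show ?thesis using fin(2) by simp
  qed
  have "(\<Sum>i\<in>A. \<Sum>T \<bullet> i) = card (A \<inter> T)" if A: "A \<subseteq> Basis" for A
  proof -
    have "(\<Sum>i\<in>A. \<Sum>T \<bullet> i) = (\<Sum>i\<in>A. if i \<in> T then 1 else 0)"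
      by (rule sum.cong) (use A ind in auto)
    also have "\<dots> = card (A \<inter> T)" using finite_subset[OF A] by (simp flip: sum.inter_restrict)
    finally show ?thesis .
  qed
  moreover have "(Basis - S) \<inter> T = T - S" using assms by auto
  ultimately show ?thesis unfolding inner_weight_vector using assms by simp
qed

lemma inner_weight_vector_sum_self:
  fixes S :: "'a::euclidean_space set"
  assumes "S \<subseteq> Basis" "S \<noteq> {}"
  shows "weight_vector S \<bullet> \<Sum>S = 1"
  using assms finite_subset[OF assms(1)] by (simp add: inner_weight_vector_sum card_gt_0_iff)

text \<open>As S is nonempty, T - S has at most d - 1 elements, so with weight 1/d the penalty stays
  below 1 and the value above -1. From above, either an element of S is missing or an extra element
  causes a positive penalty.\<close>

lemma inner_weight_vector_sum_less:
  fixes S T :: "'a::euclidean_space set"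
  assumes S: "S \<subseteq> Basis" "S \<noteq> {}" and T: "T \<subseteq> Basis" and ne: "S \<noteq> T"
  shows "\<bar>weight_vector S \<bullet> \<Sum>T\<bar> < 1"
proof -
  have fin: "finite S" "finite T" using S T by (auto intro: finite_subset)
  have cS: "card S \<ge> 1" using S fin by (simp add: Suc_le_eq card_gt_0_iff)
  have "card (T - S) < DIM('a)"
    using S T by (intro psubset_card_mono) auto
  then have small: "real (card (T - S)) / DIM('a) < 1" by simp
  have le: "card (S \<inter> T) \<le> card S" using fin by (intro card_mono) auto
  have "card (S \<inter> T) < card S \<or> 0 < card (T - S)"
  proof (cases "T - S = {}")
    case True
    then have "S \<inter> T \<subset> S" using ne by auto
    then show ?thesis using psubset_card_mono[OF fin(1)] by blast
  next
    case False
    then show ?thesis using fin by (simp add: card_gt_0_iff)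
  qed
  moreover have "real (card (T - S)) / DIM('a) \<ge> 0" by simp
  moreover have "real (card (T - S)) / DIM('a) > 0" if "0 < card (T - S)" using that by simp
  ultimately have "real (card (S \<inter> T)) - card (T - S) / DIM('a) < card S"
    using le by linarith
  moreover have "- real (card S) < real (card (S \<inter> T)) - card (T - S) / DIM('a)"
    using small cS by linarith
  ultimately have "\<bar>real (card (S \<inter> T)) - card (T - S) / DIM('a)\<bar> < card S" by linarith
  then show ?thesis unfolding inner_weight_vector_sum[OF S(1) T] using cS by (simp add: abs_divide)
qed

text \<open>Positive integer coordinates are at least 1 and contribute at least
  \<open>card S\<close>; the others are nonpositive and carry negative weight, so they cannot lower
  the sum.\<close>

lemma inner_weight_vector_ge_1:
  fixes w :: "'a::euclidean_space"
  assumes w: "w \<in> int_lattice" and i: "i \<in> Basis" "w \<bullet> i > 0"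
  shows "1 \<le> weight_vector {i \<in> Basis. w \<bullet> i > 0} \<bullet> w"
proof -
  define S where "S = {i \<in> Basis. w \<bullet> i > 0}"
  have S: "finite S" "S \<noteq> {}" using i by (auto simp: S_def)
  then have cS: "card S > 0" by (simp add: card_gt_0_iff)
  have "(\<Sum>j\<in>S. 1) \<le> (\<Sum>j\<in>S. w \<bullet> j)"
  proof (rule sum_mono)
    fix j assume "j \<in> S"
    then have "w \<bullet> j \<in> \<int>" "w \<bullet> j > 0" using w by (auto simp: S_def int_lattice_def)
    then show "1 \<le> w \<bullet> j" using Ints_nonzero_abs_ge1[of "w \<bullet> j"] by simp
  qed
  moreover have "(\<Sum>j\<in>Basis - S. w \<bullet> j) \<le> 0" by (rule sum_nonpos) (auto simp: S_def)
  then have "(\<Sum>j\<in>Basis - S. w \<bullet> j) / DIM('a) \<le> 0" by (simp add: divide_nonpos_pos)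
  ultimately have "real (card S) \<le> (\<Sum>j\<in>S. w \<bullet> j) - (\<Sum>j\<in>Basis - S. w \<bullet> j) / DIM('a)" by simp
  then show ?thesis unfolding S_def[symmetric] inner_weight_vector using cS by simp
qed

text \<open>Adding the bounds for S = \<open>Basis\<close> and S = {i} cancels the coordinate sum
  and leaves c_i (1 + 1/d). With r = 1 this bounds the polar; with r = 0 it shows that the weight
  vectors span.\<close>

lemma abs_coordinate_le_weight_vector:
  fixes c :: "'a::euclidean_space"
  assumes bound: "\<And>S. S \<subseteq> Basis \<Longrightarrow> S \<noteq> {} \<Longrightarrow> \<bar>weight_vector S \<bullet> c\<bar> \<le> r" and i: "i \<in> Basis"
  shows "\<bar>c \<bullet> i\<bar> \<le> 2 * r"
proof -
  define d where "d = real DIM('a)"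
  have d: "d > 0" by (simp add: d_def)
  define s where "s = (\<Sum>j\<in>Basis. c \<bullet> j)"
  have "\<bar>s / d\<bar> \<le> r" using bound[of Basis] by (simp add: inner_weight_vector s_def d_def)
  moreover have "(\<Sum>j\<in>Basis - {i}. c \<bullet> j) = s - c \<bullet> i" using i by (simp add: s_def sum_diff1)
  then have "\<bar>c \<bullet> i - (s - c \<bullet> i) / d\<bar> \<le> r" using bound[of "{i}"] i by (simp add: inner_weight_vector d_def)
  moreover have "c \<bullet> i - (s - c \<bullet> i) / d = c \<bullet> i + (c \<bullet> i) / d - s / d" by (simp add: diff_divide_distrib)
  ultimately have "\<bar>c \<bullet> i + (c \<bullet> i) / d\<bar> \<le> 2 * r" by linarith
  moreover have "c \<bullet> i + (c \<bullet> i) / d = (c \<bullet> i) * (1 + 1 / d)" by (simp add: algebra_simps)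
  then have "\<bar>c \<bullet> i + (c \<bullet> i) / d\<bar> = \<bar>c \<bullet> i\<bar> * (1 + 1 / d)" using d by (simp add: abs_mult)
  moreover have "\<bar>c \<bullet> i\<bar> * 1 \<le> \<bar>c \<bullet> i\<bar> * (1 + 1 / d)" using d by (intro mult_left_mono) auto
  ultimately show ?thesis by linarith
qed

section \<open>The symmetric configuration and its exposing integer vectors\<close>

definition weight_vectors :: "'a::euclidean_space set" where
  "weight_vectors = (let W = weight_vector ` {S. S \<subseteq> Basis \<and> S \<noteq> {}} in W \<union> uminus ` W)"

lemma weight_vectors_cases:
  assumes "g \<in> weight_vectors"
  obtains S \<sigma> where "S \<subseteq> Basis" "S \<noteq> {}" "\<sigma> = 1 \<or> \<sigma> = (-1::real)" "g = \<sigma> *\<^sub>R weight_vector S"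
proof -
  from assms consider S where "S \<subseteq> Basis" "S \<noteq> {}" "g = weight_vector S"
    | S where "S \<subseteq> Basis" "S \<noteq> {}" "g = - weight_vector S"
    unfolding weight_vectors_def Let_def by blast
  then show ?thesis
  proof cases
    case 1 then show ?thesis using that[of S 1] by simp
  next
    case 2 then show ?thesis using that[of S "-1"] by simp
  qed
qed

lemma weight_vectors_uminus: "g \<in> weight_vectors \<Longrightarrow> - g \<in> weight_vectors"
  unfolding weight_vectors_def Let_def by (auto simp: image_image)

lemma finite_weight_vectors: "finite (weight_vectors :: 'a::euclidean_space set)"
  unfolding weight_vectors_def Let_def by auto

lemma card_weight_vectors: "card (weight_vectors :: 'a::euclidean_space set) = 2 ^ (DIM('a) + 1) - 2"
proof -
  let ?\<S> = "{S. S \<subseteq> (Basis :: 'a set) \<and> S \<noteq> {}}"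
  let ?W = "weight_vector ` ?\<S>"
  \<comment> \<open>The pairing with \<open>\<Sum>T\<close> recognises T up to sign, which gives
    injectivity and also keeps the configuration apart from its negative.\<close>
  have val: "S = T" if "S \<in> ?\<S>" "T \<in> ?\<S>" "\<bar>weight_vector S \<bullet> \<Sum>T\<bar> = 1" for S T
    using inner_weight_vector_sum_less[of S T] that by fastforce
  have self: "weight_vector T \<bullet> \<Sum>T = 1" if "T \<in> ?\<S>" for T
    using inner_weight_vector_sum_self[of T] that by blast
  have inj: "inj_on weight_vector ?\<S>"
  proof (rule inj_onI)
    fix S T assume ST: "S \<in> ?\<S>" "T \<in> ?\<S>" "weight_vector S = weight_vector T"
    show "S = T" by (rule val[OF ST(1,2)]) (simp only: ST(3) self[OF ST(2)] abs_one)
  qed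
  have disj: "?W \<inter> uminus ` ?W = {}"
  proof (rule equals0I)
    fix x assume "x \<in> ?W \<inter> uminus ` ?W"
    then obtain S T where ST: "S \<in> ?\<S>" "T \<in> ?\<S>" "x = weight_vector S" "x = - weight_vector T" by blast
    have *: "weight_vector S \<bullet> \<Sum>T = - 1"
      using ST(3,4) self[OF ST(2)] by (metis inner_minus_left)
    have "S = T" by (rule val[OF ST(1,2)]) (simp only: * abs_minus_cancel abs_one)
    then show False using * self[OF ST(2)] by simp
  qed
  have "?\<S> = Pow Basis - {{}}" by auto
  then have c\<S>: "card ?\<S> = 2 ^ DIM('a) - 1" by (simp add: card_Pow)
  have "card (?W \<union> uminus ` ?W) = card ?W + card (uminus ` ?W)"
    using disj by (intro card_Un_disjoint) auto
  also have "\<dots> = card ?\<S> + card ?\<S>" using card_image[OF inj] by (simp add: card_image)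
  finally show ?thesis using c\<S> unfolding weight_vectors_def Let_def by simp
qed

lemma weight_vectors_exposed:
  fixes g :: "'a::euclidean_space"
  assumes "g \<in> weight_vectors"
  obtains u where "u \<in> int_lattice" "u \<noteq> 0" "g \<bullet> u = 1"
    "\<And>h. h \<in> weight_vectors \<Longrightarrow> h \<noteq> g \<Longrightarrow> h \<bullet> u < 1"
proof -
  obtain S \<sigma> where S: "S \<subseteq> Basis" "S \<noteq> {}" and \<sigma>: "\<sigma> = 1 \<or> \<sigma> = (-1::real)"
    and g: "g = \<sigma> *\<^sub>R weight_vector S" using weight_vectors_cases[OF assms] .
  have self: "weight_vector S \<bullet> \<Sum>S = 1" by (rule inner_weight_vector_sum_self[OF S])
  show ?thesis
  proof (rule that[of "\<sigma> *\<^sub>R \<Sum>S"])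
    show gu: "g \<bullet> (\<sigma> *\<^sub>R \<Sum>S) = 1" using \<sigma> self by (auto simp: g)
    then show "\<sigma> *\<^sub>R \<Sum>S \<noteq> 0" by auto
    show "\<sigma> *\<^sub>R \<Sum>S \<in> int_lattice"
      using \<sigma> sum_Basis_in_int_lattice[OF S(1)] by (auto simp: int_lattice_def)
    fix h assume h: "h \<in> weight_vectors" "h \<noteq> g"
    obtain T \<tau> where T: "T \<subseteq> Basis" "T \<noteq> {}" and \<tau>: "\<tau> = 1 \<or> \<tau> = (-1::real)"
      and h': "h = \<tau> *\<^sub>R weight_vector T" using weight_vectors_cases[OF h(1)] .
    show "h \<bullet> (\<sigma> *\<^sub>R \<Sum>S) < 1"
    proof (cases "S = T")
      case True
      then have "\<tau> \<noteq> \<sigma>" using h(2) g h' by auto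
      then show ?thesis using \<sigma> \<tau> self True by (auto simp: h')
    next
      case False
      then have "\<bar>weight_vector T \<bullet> \<Sum>S\<bar> < 1" using inner_weight_vector_sum_less[OF T S(1)] by auto
      then show ?thesis using \<sigma> \<tau> by (auto simp: h')
    qed
  qed
qed

lemma weight_vectors_inner_ge_1:
  fixes w :: "'a::euclidean_space"
  assumes "w \<in> int_lattice" "w \<noteq> 0"
  obtains g where "g \<in> weight_vectors" "1 \<le> g \<bullet> w"
proof -
  obtain i where i: "i \<in> Basis" "w \<bullet> i \<noteq> 0" using assms(2) euclidean_all_zero_iff[of w] by auto
  have mem: "weight_vector {i \<in> Basis. x \<bullet> i > 0} \<in> weight_vectors" if "x \<bullet> i > 0" for x :: 'a
    using i(1) that unfolding weight_vectors_def Let_def by blast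
  show ?thesis
  proof (cases "w \<bullet> i > 0")
    case True
    then show ?thesis using that[OF mem[OF True]] inner_weight_vector_ge_1[OF assms(1) i(1)] by blast
  next
    case False
    then have pos: "(- w) \<bullet> i > 0" using i(2) by simp
    have "- w \<in> int_lattice" using assms(1) by (auto simp: int_lattice_def)
    from inner_weight_vector_ge_1[OF this i(1) pos]
    show ?thesis using that[OF weight_vectors_uminus[OF mem[OF pos]]] by simp
  qed
qed

lemma abs_coordinate_le:
  fixes c :: "'a::euclidean_space"
  assumes "\<And>g. g \<in> weight_vectors \<Longrightarrow> g \<bullet> c \<le> r" and i: "i \<in> Basis"
  shows "\<bar>c \<bullet> i\<bar> \<le> 2 * r"
proof (rule abs_coordinate_le_weight_vector[OF _ i])
  fix S :: "'a set" assume "S \<subseteq> Basis" "S \<noteq> {}"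
  then have "weight_vector S \<in> weight_vectors" unfolding weight_vectors_def Let_def by blast
  then show "\<bar>weight_vector S \<bullet> c\<bar> \<le> r"
    using assms(1)[of "weight_vector S"] assms(1)[OF weight_vectors_uminus] by fastforce
qed

section \<open>The hull as a lattice reduced polytope\<close>

lemma convex_body_hull_weight_vectors: "convex_body (convex hull (weight_vectors :: 'a::euclidean_space set))"
proof -
  let ?P = "convex hull (weight_vectors :: 'a set)"
  have "interior ?P \<noteq> {}"
  proof
    assume "interior ?P = {}"
    then obtain a b where a: "a \<noteq> 0" "?P \<subseteq> {x. a \<bullet> x = b}"
      using empty_interior_subset_hyperplane[of ?P] convex_convex_hull by blast
    have "a \<bullet> g = b" if "g \<in> weight_vectors" for g
      using a(2) hull_inc[OF that, of convex] by blast
    \<comment> \<open>A hyperplane containing a symmetric set passes through 0, so its normal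
      annihilates all weight vectors and vanishes by the coordinate bound with r = 0.\<close>
    then have "a \<bullet> g = b \<and> a \<bullet> (- g) = b" if "g \<in> weight_vectors" for g
      using that weight_vectors_uminus[OF that] by blast
    then have "g \<bullet> a = 0" if "g \<in> weight_vectors" for g
      using that by (fastforce simp: inner_commute[of g a])
    then have "\<bar>a \<bullet> i\<bar> \<le> 2 * 0" if "i \<in> Basis" for i
      by (intro abs_coordinate_le that) simp
    then show False using a(1) euclidean_all_zero_iff[of a] by auto
  qed
  then show ?thesis
    unfolding convex_body_def by (auto intro: finite_imp_compact_convex_hull finite_weight_vectors)
qed

lemma inner_le_hull:
  assumes "\<And>h. h \<in> S \<Longrightarrow> h \<bullet> u \<le> r" "x \<in> convex hull S"
  shows "u \<bullet> x \<le> r"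
proof -
  have "convex hull S \<subseteq> {x. u \<bullet> x \<le> r}"
    by (intro hull_minimal convex_halfspace_le) (use assms(1) in \<open>auto simp: inner_commute\<close>)
  then show ?thesis using assms(2) by blast
qed

lemma inner_less_hull:
  assumes "\<And>h. h \<in> S \<Longrightarrow> h \<bullet> u < r" "x \<in> convex hull S"
  shows "u \<bullet> x < r"
proof -
  have "convex hull S \<subseteq> {x. u \<bullet> x < r}"
    by (intro hull_minimal convex_halfspace_lt) (use assms(1) in \<open>auto simp: inner_commute\<close>)
  then show ?thesis using assms(2) by blast
qed

lemma extreme_points_hull_weight_vectors:
  "{v. v extreme_point_of (convex hull (weight_vectors :: 'a::euclidean_space set))} = weight_vectors"
proof -
  have "g \<notin> convex hull (weight_vectors - {g})" if g: "g \<in> weight_vectors" for g :: 'a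
  proof
    assume g': "g \<in> convex hull (weight_vectors - {g})"
    obtain u where u: "g \<bullet> u = 1" "\<And>h. h \<in> weight_vectors \<Longrightarrow> h \<noteq> g \<Longrightarrow> h \<bullet> u < 1"
      using weight_vectors_exposed[OF g] by metis
    have "u \<bullet> g < 1" by (rule inner_less_hull[OF _ g']) (use u(2) in auto)
    then show False using u(1) by (simp add: inner_commute)
  qed
  then show ?thesis
    using extreme_point_of_convex_hull_convex_independent[OF finite_imp_compact[OF finite_weight_vectors]] by blast
qed

lemma hull_weight_vectors_exposed:
  fixes g :: "'a::euclidean_space"
  assumes g: "g \<in> weight_vectors" and u: "g \<bullet> u = 1"
    "\<And>h. h \<in> weight_vectors \<Longrightarrow> h \<noteq> g \<Longrightarrow> h \<bullet> u < 1"
    and x: "x \<in> convex hull weight_vectors" "u \<bullet> x \<ge> 1"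
  shows "x = g"
proof (cases "weight_vectors = {g}")
  case True
  show ?thesis using x(1) unfolding True by simp
next
  case False
  let ?H = "weight_vectors - {g}"
  have "?H \<noteq> {}" using False g by blast
  moreover have "insert g ?H = weight_vectors" using g by blast
  ultimately obtain s t h where st: "s \<ge> 0" "t \<ge> 0" "s + t = (1::real)" "h \<in> convex hull ?H"
    "x = s *\<^sub>R g + t *\<^sub>R h" using x(1) convex_hull_insert[of ?H g] by auto
  have "u \<bullet> h < 1" by (rule inner_less_hull[OF _ st(4)]) (use u(2) in auto)
  moreover have "u \<bullet> x = s + t * (u \<bullet> h)" using st(5) u(1) by (simp add: inner_add_right inner_commute)
  then have "t \<le> t * (u \<bullet> h)" using x(2) st(3) by simp
  ultimately have "t = 0" using st(2) by (metis less_le mult_less_cancel_left_pos mult.right_neutral not_less)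
  then show ?thesis using st by simp
qed

text \<open>Every nonzero integer direction sees some pair g, -g at width at least 2. A proper
  convex subbody misses some weight vector g, and the integer vector exposing g then has support
  below 1 on one side and at most 1 on the other.\<close>

lemma lattice_reduced_hull_weight_vectors:
  "lattice_reduced int_lattice (convex hull (weight_vectors :: 'a::euclidean_space set))"
  unfolding lattice_reduced_def
proof (intro conjI allI impI)
  let ?P = "convex hull (weight_vectors :: 'a set)"
  show P: "convex_body ?P" by (rule convex_body_hull_weight_vectors)
  have bP: "bounded ?P" by (rule convex_body_bounded[OF P])
  fix D assume "convex_body D \<and> D \<subset> ?P"
  then have D: "convex_body D" "D \<subset> ?P" by auto
  have cD: "compact D" "D \<noteq> {}" "convex D" using D by (auto simp: convex_body_def)
  have ne: "\<exists>u::'a. u \<in> int_lattice \<and> u \<noteq> 0"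
    using full_lattice_nonzero[OF full_lattice_int_lattice] by metis
  have wP: "2 \<le> lattice_width int_lattice ?P"
    unfolding lattice_width_eq_INF[OF P] dual_lattice_int_lattice
  proof (rule cINF_greatest)
    show "int_lattice - {0 :: 'a} \<noteq> {}" using ne by blast
    fix y :: 'a assume "y \<in> int_lattice - {0}"
    then obtain g where g: "g \<in> weight_vectors" "1 \<le> g \<bullet> y" using weight_vectors_inner_ge_1[of y] by blast
    have "y \<bullet> (g - (- g)) \<le> dwidth ?P y"
      using g(1) weight_vectors_uminus by (intro dwidth_ge[OF bP] hull_inc)
    then show "2 \<le> dwidth ?P y" using g(2) by (simp add: inner_add_right inner_commute[of y])
  qed
  have "\<not> weight_vectors \<subseteq> D" using D(2) cD(3) hull_minimal[of weight_vectors D convex] by blast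
  then obtain g where g: "g \<in> weight_vectors" "g \<notin> D" by blast
  obtain u where u: "u \<in> int_lattice" "u \<noteq> 0" "g \<bullet> u = 1"
    "\<And>h. h \<in> weight_vectors \<Longrightarrow> h \<noteq> g \<Longrightarrow> h \<bullet> u < 1"
    using weight_vectors_exposed[OF g(1)] by metis
  have le1: "h \<bullet> u \<le> 1" if "h \<in> weight_vectors" for h using u(3,4) that by (cases "h = g") (auto intro: less_imp_le)
  have "supp D u < 1"
  proof -
    obtain c where c: "c \<in> D" "u \<bullet> c = supp D u" using supp_attained[OF cD(1,2)] by metis
    have "c \<noteq> g" using c(1) g(2) by blast
    then have "\<not> u \<bullet> c \<ge> 1" using hull_weight_vectors_exposed[OF g(1) u(3,4), of c] c(1) D(2) by blast
    then show ?thesis using c(2) by simp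
  qed
  moreover have "supp D (- u) \<le> 1"
  proof (rule supp_least[OF cD(2)])
    fix x assume "x \<in> D"
    then have "x \<in> ?P" using D(2) by blast
    then show "- u \<bullet> x \<le> 1"
      by (rule inner_le_hull[rotated]) (use le1[OF weight_vectors_uminus] in simp)
  qed
  ultimately have "dwidth D u < 2" unfolding dwidth_def by linarith
  moreover have "lattice_width int_lattice D \<le> dwidth D u"
    using lattice_width_le[OF D(1)] u(1,2) by (simp add: dual_lattice_int_lattice)
  ultimately show "lattice_width int_lattice D \<noteq> lattice_width int_lattice ?P" using wP by linarith
qed

section \<open>The polar as a lattice complete polytope\<close>

definition weight_polar :: "'a::euclidean_space set" where
  "weight_polar = {x. \<forall>g\<in>weight_vectors. g \<bullet> x \<le> 1}"

lemma zero_notin_weight_vectors: "0 \<notin> (weight_vectors :: 'a::euclidean_space set)"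
  using weight_vectors_exposed[of "0 :: 'a"] by force

lemma open_weight_polar_strict:
  "open {x :: 'a::euclidean_space. \<forall>h \<in> weight_vectors - A. h \<bullet> x < 1}"
proof -
  have "{x :: 'a. \<forall>h \<in> weight_vectors - A. h \<bullet> x < 1} = (\<Inter>h\<in>weight_vectors - A. {x. h \<bullet> x < 1})" by auto
  then show ?thesis using finite_weight_vectors by (auto intro!: open_INT open_halfspace_lt)
qed

lemma convex_body_weight_polar: "convex_body (weight_polar :: 'a::euclidean_space set)"
proof -
  have eq: "weight_polar = (\<Inter>g\<in>weight_vectors. {x :: 'a. g \<bullet> x \<le> 1})" by (auto simp: weight_polar_def)
  have "closed (weight_polar :: 'a set)" "convex (weight_polar :: 'a set)"
    unfolding eq by (auto intro!: closed_INT convex_INT closed_halfspace_le convex_halfspace_le)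
  moreover have "bounded (weight_polar :: 'a set)"
  proof (rule boundedI)
    fix x :: 'a assume "x \<in> weight_polar"
    then have "\<bar>x \<bullet> i\<bar> \<le> 2 * 1" if "i \<in> Basis" for i
      using that by (intro abs_coordinate_le) (auto simp: weight_polar_def)
    then have "(\<Sum>i\<in>Basis. \<bar>x \<bullet> i\<bar>) \<le> (\<Sum>i\<in>(Basis :: 'a set). 2)" by (intro sum_mono) simp
    then show "norm x \<le> (\<Sum>i\<in>(Basis :: 'a set). 2)" using norm_le_l1[of x] by linarith
  qed
  moreover have "interior (weight_polar :: 'a set) \<noteq> {}"
  proof -
    have "{x :: 'a. \<forall>h \<in> weight_vectors - {}. h \<bullet> x < 1} \<subseteq> interior weight_polar"
      by (rule interior_maximal[OF _ open_weight_polar_strict]) (auto simp: weight_polar_def intro: less_imp_le)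
    moreover have "(0 :: 'a) \<in> {x. \<forall>h \<in> weight_vectors - {}. h \<bullet> x < 1}" by simp
    ultimately show ?thesis by blast
  qed
  ultimately show ?thesis by (simp add: convex_body_def compact_eq_bounded_closed)
qed

lemma facets_weight_polar:
  "polytope (weight_polar :: 'a::euclidean_space set) \<and>
    card {F. F facet_of (weight_polar :: 'a set)} = 2 ^ (DIM('a) + 1) - 2"
proof -
  let ?Q = "weight_polar :: 'a set"
  define F where "F g = ?Q \<inter> {x. g \<bullet> x = 1}" for g
  have poly: "polytope ?Q" and sub: "{G. G facet_of ?Q} \<subseteq> F ` weight_vectors"
    using halfspaces_polytope_facets[OF convex_body_weight_polar finite_weight_vectors zero_notin_weight_vectors
        weight_polar_def] unfolding F_def by auto
  have cvx: "convex ?Q" using convex_body_weight_polar by (auto simp: convex_body_def)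
  have dimQ: "aff_dim ?Q = DIM('a)"
    using convex_body_weight_polar by (auto simp: convex_body_def intro!: aff_dim_nonempty_interior)
  have facet: "F g facet_of ?Q" if g: "g \<in> weight_vectors" for g
  proof -
    obtain u where u: "g \<bullet> u = 1" "\<And>h. h \<in> weight_vectors \<Longrightarrow> h \<noteq> g \<Longrightarrow> h \<bullet> u < 1"
      using weight_vectors_exposed[OF g] by metis
    have g0: "g \<noteq> 0" using g zero_notin_weight_vectors by blast
    define W where "W = {x :: 'a. \<forall>h \<in> weight_vectors - {g}. h \<bullet> x < 1}"
    have uW: "u \<in> {x. g \<bullet> x = 1} \<inter> W" using u by (auto simp: W_def)
    \<comment> \<open>Near u all other constraints are slack, so an open piece of the hyperplane g =
      1 belongs to the face and gives it dimension d - 1.\<close>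
    have "affine hull ({x. g \<bullet> x = 1} \<inter> W) = affine hull {x. g \<bullet> x = 1}"
      using uW open_weight_polar_strict[of "{g}"] unfolding W_def
      by (intro affine_hull_convex_Int_open convex_hyperplane) auto
    then have "aff_dim ({x. g \<bullet> x = 1} \<inter> W) = DIM('a) - 1"
      using aff_dim_hyperplane[OF g0, of 1] by (metis aff_dim_affine_hull)
    moreover have "{x. g \<bullet> x = 1} \<inter> W \<subseteq> F g"
    proof
      fix x assume x: "x \<in> {x. g \<bullet> x = 1} \<inter> W"
      have "h \<bullet> x \<le> 1" if "h \<in> weight_vectors" for h
        using x that by (cases "h = g") (auto simp: W_def intro: less_imp_le)
      then show "x \<in> F g" using x by (auto simp: F_def weight_polar_def)
    qed
    moreover have "F g \<subseteq> {x. g \<bullet> x = 1}" by (auto simp: F_def)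
    ultimately have "aff_dim (F g) = DIM('a) - 1"
      using aff_dim_subset[of "{x. g \<bullet> x = 1} \<inter> W" "F g"] aff_dim_subset[of "F g" "{x. g \<bullet> x = 1}"]
        aff_dim_hyperplane[OF g0, of 1] by linarith
    moreover have "F g face_of ?Q"
      unfolding F_def by (intro face_of_Int_supporting_hyperplane_le[OF cvx]) (use g in \<open>auto simp: weight_polar_def\<close>)
    moreover have "F g \<noteq> {}" using \<open>{x. g \<bullet> x = 1} \<inter> W \<subseteq> F g\<close> uW by blast
    ultimately show ?thesis using dimQ by (simp add: facet_of_def of_nat_diff)
  qed
  then have "{G. G facet_of ?Q} = F ` weight_vectors" using sub by blast
  moreover have "inj_on F weight_vectors"
  proof (rule inj_onI)
    fix g h :: 'a assume gh: "g \<in> weight_vectors" "h \<in> weight_vectors" "F g = F h"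
    obtain u where u: "g \<bullet> u = 1" "\<And>h. h \<in> weight_vectors \<Longrightarrow> h \<noteq> g \<Longrightarrow> h \<bullet> u < 1"
      using weight_vectors_exposed[OF gh(1)] by metis
    have "h \<bullet> u \<le> 1" if "h \<in> weight_vectors" for h
      using u that by (cases "h = g") (auto intro: less_imp_le)
    then have "u \<in> F g" using u(1) by (auto simp: F_def weight_polar_def)
    then have "h \<bullet> u = 1" unfolding gh(3) by (auto simp: F_def)
    then show "g = h" using u(2)[OF gh(2)] by force
  qed
  ultimately show ?thesis using poly card_weight_vectors[where 'a='a] by (simp add: card_image)
qed

text \<open>A functional g with g . v >= 1 confines the body to a slab, so its diameter is at most
  2. A point x beyond the facet of g lengthens the segment from -u to u, because u is in the
  relative interior of that facet.\<close>

lemma lattice_complete_weight_polar: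
  "lattice_complete int_lattice (weight_polar :: 'a::euclidean_space set)"
  unfolding lattice_complete_def
proof (intro conjI allI impI)
  let ?Q = "weight_polar :: 'a set"
  note L = full_lattice_int_lattice
  show Q: "convex_body ?Q" by (rule convex_body_weight_polar)
  fix X assume "convex_body X \<and> ?Q \<subset> X"
  then have X: "convex_body X" "?Q \<subset> X" by auto
  have cvxX: "convex X" using X(1) by (simp add: convex_body_def)
  have "lattice_diam int_lattice ?Q \<le> 2"
  proof (rule lattice_diam_least[OF L])
    fix v p q :: 'a and s :: real
    assume v: "v \<in> int_lattice" "v \<noteq> 0" and pq: "p \<in> ?Q" "q \<in> ?Q" "q - p = s *\<^sub>R v"
    obtain g where g: "g \<in> weight_vectors" "1 \<le> g \<bullet> v" using weight_vectors_inner_ge_1[OF v] .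
    have "g \<bullet> q \<le> 1" "(- g) \<bullet> p \<le> 1"
      using pq g(1) weight_vectors_uminus[OF g(1)] by (auto simp: weight_polar_def simp del: inner_minus_left)
    then have "g \<bullet> (q - p) \<le> 2" by (simp add: inner_diff_right)
    then have *: "s * (g \<bullet> v) \<le> 2" using pq(3) by simp
    show "s \<le> 2"
    proof (cases "s \<ge> 0")
      case True
      then have "s * 1 \<le> s * (g \<bullet> v)" using g(2) by (intro mult_left_mono) auto
      then show ?thesis using * by simp
    qed simp
  qed simp
  moreover have "2 < lattice_diam int_lattice X"
  proof -
    obtain x where x: "x \<in> X" "x \<notin> ?Q" using X(2) by blast
    then obtain g where g: "g \<in> weight_vectors" "g \<bullet> x > 1" by (auto simp: weight_polar_def not_le)
    obtain u where u: "u \<in> int_lattice" "u \<noteq> 0" "g \<bullet> u = 1"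
      "\<And>h. h \<in> weight_vectors \<Longrightarrow> h \<noteq> g \<Longrightarrow> h \<bullet> u < 1"
      using weight_vectors_exposed[OF g(1)] by metis
    have le1: "h \<bullet> u \<le> 1" if "h \<in> weight_vectors" for h
      using u(3,4) that by (cases "h = g") (auto intro: less_imp_le)
    have mu: "- u \<in> ?Q" using le1[OF weight_vectors_uminus] by (auto simp: weight_polar_def)
    define \<eta> where "\<eta> = g \<bullet> x - 1"
    have \<eta>: "\<eta> > 0" using g(2) by (simp add: \<eta>_def)
    \<comment> \<open>Solved from (1 - t) f t + t x = (1 + \<eta> t) u. The excess \<eta> of x over
      the facet is the rate that keeps f t on the hyperplane g = 1, and f t tends to u, so it lies
      in the facet for small t.\<close>
    define f where "f t = (1 / (1 - t)) *\<^sub>R ((1 + \<eta> * t) *\<^sub>R u - t *\<^sub>R x)" for t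
    have "(f \<longlongrightarrow> (1 / (1 - 0)) *\<^sub>R ((1 + \<eta> * 0) *\<^sub>R u - 0 *\<^sub>R x)) (at_right 0)"
      unfolding f_def by (intro tendsto_intros) auto
    then have lim: "(f \<longlongrightarrow> u) (at_right 0)" by simp
    let ?W = "{x :: 'a. \<forall>h \<in> weight_vectors - {g}. h \<bullet> x < 1}"
    have "u \<in> ?W" using u(4) by auto
    then have "eventually (\<lambda>t. f t \<in> ?W) (at_right 0)"
      using topological_tendstoD[OF lim open_weight_polar_strict[of "{g}"]] by blast
    moreover have "eventually (\<lambda>t::real. t \<in> {0<..<1}) (at_right 0)" by (rule eventually_at_right_real) simp
    ultimately have "eventually (\<lambda>t. f t \<in> ?W \<and> t \<in> {0<..<1}) (at_right (0::real))" by (rule eventually_conj)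
    then obtain t where t: "f t \<in> ?W" "0 < t" "t < 1"
      using eventually_happens'[OF trivial_limit_at_right_real] by (metis (no_types, lifting) greaterThanLessThan_iff)
    have "g \<bullet> f t = ((1 + \<eta> * t) - t * (1 + \<eta>)) / (1 - t)"
      using u(3) by (simp add: f_def inner_diff_right \<eta>_def)
    also have "\<dots> = 1" using t by (simp add: field_simps)
    finally have gf: "g \<bullet> f t = 1" .
    have "h \<bullet> f t \<le> 1" if "h \<in> weight_vectors" for h
      using t(1) gf that by (cases "h = g") (auto intro: less_imp_le)
    then have "f t \<in> X" using X(2) by (auto simp: weight_polar_def)
    then have "(1 - t) *\<^sub>R f t + t *\<^sub>R x \<in> X" using t x(1) by (intro convexD[OF cvxX]) auto
    moreover have "(1 - t) *\<^sub>R f t + t *\<^sub>R x = (1 + \<eta> * t) *\<^sub>R u" using t by (simp add: f_def)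
    ultimately have "(1 + \<eta> * t) *\<^sub>R u \<in> X" by simp
    moreover have "- u \<in> X" using mu X(2) by blast
    moreover have "(1 + \<eta> * t) *\<^sub>R u - (- u) = (2 + \<eta> * t) *\<^sub>R u" by (simp add: algebra_simps flip: scaleR_2)
    ultimately have "2 + \<eta> * t \<le> lattice_diam int_lattice X"
      using lattice_diam_upper[OF L X(1) u(1,2)] by blast
    moreover have "\<eta> * t > 0" using \<eta> t by simp
    ultimately show ?thesis by linarith
  qed
  ultimately show "lattice_diam int_lattice X \<noteq> lattice_diam int_lattice ?Q" by linarith
qed

theorem theorem1p2:
  fixes L :: "'a::euclidean_space set" and C :: "'a set"
  assumes "full_lattice L" and "convex_body C"
  shows "(lattice_reduced L C \<longrightarrow>
            polytope C \<and> card {v. v extreme_point_of C} \<le> 2 ^ (DIM('a) + 1) - 2)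
       \<and> (lattice_complete L C \<longrightarrow>
            polytope C \<and> card {F. F facet_of C} \<le> 2 ^ (DIM('a) + 1) - 2)
       \<and> (\<exists>(L'::'a set) P. full_lattice L' \<and> lattice_reduced L' P \<and> polytope P \<and>
            card {v. v extreme_point_of P} = 2 ^ (DIM('a) + 1) - 2)
       \<and> (\<exists>(L'::'a set) P. full_lattice L' \<and> lattice_complete L' P \<and> polytope P \<and>
            card {F. F facet_of P} = 2 ^ (DIM('a) + 1) - 2)"
proof (intro conjI impI)
  let ?P = "convex hull (weight_vectors :: 'a set)"
  have "polytope ?P" unfolding polytope_def using finite_weight_vectors by blast
  moreover have "card {v. v extreme_point_of ?P} = 2 ^ (DIM('a) + 1) - 2"
    unfolding extreme_points_hull_weight_vectors by (rule card_weight_vectors)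
  ultimately show "\<exists>(L'::'a set) P. full_lattice L' \<and> lattice_reduced L' P \<and> polytope P \<and>
      card {v. v extreme_point_of P} = 2 ^ (DIM('a) + 1) - 2"
    using full_lattice_int_lattice lattice_reduced_hull_weight_vectors by blast
  show "\<exists>(L'::'a set) P. full_lattice L' \<and> lattice_complete L' P \<and> polytope P \<and>
      card {F. F facet_of P} = 2 ^ (DIM('a) + 1) - 2"
    using full_lattice_int_lattice lattice_complete_weight_polar facets_weight_polar by blast
qed (use lattice_reduced_vertices[OF assms(1)] lattice_complete_facets[OF assms(1)] in auto)

end
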